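(* There is an online algorithm for online sorting of $n$ items drawn independently and uniformly at random from $(0,1]$ which, with probability at least $1-2/n$, achieves competitive ratio $O((n\log n)^{1/4})$, i.e., its cost on the random input is at most $O((n\log n)^{1/4})$ times the offline optimum.
   Context: Online sorting: a sequence $X=(x_1,\dots,x_n)$ of reals is revealed one item at a time; upon receiving $x_j$, an online algorithm must immediately and irrevocably write it into a previously empty cell of an array $A[1],\dots,A[n]$. The cost is $\sum_{i=1}^{n-1}|A[i+1]-A[i]|$, and the offline optimum $\mathtt{OPT}(X)$ is the minimum cost over all bijective placements (equal to $\max_i x_i-\min_i x_i$). *)

theory Defs
  imports "HOL-Probability.Probability" "HOL-Combinatorics.Permutations"
    "HOL-Library.Landau_Symbols"
begin

text \<open>An input of length \<open>n\<close> is a function \<open>x :: nat \<Rightarrow> real\<close>, of which only \<open>x 1, \<dots>, x n\<close> matter.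
  A deterministic online strategy is a function \<open>alg\<close> from finite histories to cells: on the
  history \<open>[x 1, \<dots>, x j]\<close> it returns the cell into which \<open>x j\<close> is written. The cells used
  earlier are determined by the proper prefixes of the history.\<close>

definition online_cell :: "(real list \<Rightarrow> nat) \<Rightarrow> (nat \<Rightarrow> real) \<Rightarrow> nat \<Rightarrow> nat" where
  "online_cell alg x j = alg (map x [1..<Suc j])"

definition online_sorting_algorithm :: "nat \<Rightarrow> (real list \<Rightarrow> nat) \<Rightarrow> bool" where
  "online_sorting_algorithm n alg \<longleftrightarrow>
     (\<forall>x. \<forall>j\<in>{1..n}. online_cell alg x j \<in> {1..n} \<and>
        (\<forall>i\<in>{1..<j}. online_cell alg x j \<noteq> online_cell alg x i))"

text \<open>For a bijective placement \<open>p\<close> (item \<open>j\<close> is written into cell \<open>p j\<close>), this is the resulting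
  array \<open>A[1], \<dots>, A[n]\<close>.\<close>

definition filled_array :: "nat \<Rightarrow> (nat \<Rightarrow> real) \<Rightarrow> (nat \<Rightarrow> nat) \<Rightarrow> nat \<Rightarrow> real" where
  "filled_array n x p i = x (inv_into {1..n} p i)"

definition array_cost :: "nat \<Rightarrow> (nat \<Rightarrow> real) \<Rightarrow> real" where
  "array_cost n A = (\<Sum>i=1..n-1. \<bar>A (i + 1) - A i\<bar>)"

definition online_cost :: "nat \<Rightarrow> (real list \<Rightarrow> nat) \<Rightarrow> (nat \<Rightarrow> real) \<Rightarrow> real" where
  "online_cost n alg x = array_cost n (filled_array n x (online_cell alg x))"

definition offline_opt :: "nat \<Rightarrow> (nat \<Rightarrow> real) \<Rightarrow> real" where
  "offline_opt n x = Min ((\<lambda>p. array_cost n (filled_array n x p)) ` {p. p permutes {1..n}})"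

definition uniform_input :: "nat \<Rightarrow> (nat \<Rightarrow> real) measure" where
  "uniform_input n = Pi\<^sub>M {1..n} (\<lambda>_. uniform_measure lborel {0<..1})"

end

theory Submission
  imports Defs "HOL-Real_Asymp.Real_Asymp"
begin

text \<open>
  Divide \<open>(0, 1]\<close> into dyadic intervals of the levels \<open>0, \<dots>, L\<close> with \<open>2 ^ L\<close> about \<open>sqrt n\<close>, and give
  each of them a contiguous area of cells. An item is written into the area of the smallest
  interval containing it that is not yet full. The areas are so small that the subtree of an
  interval of level \<open>i\<close> has about \<open>n / 2 ^ i - 2 * sqrt (n / 2 ^ i * ln n)\<close> cells; by Chernoff's
  bound, with probability at least \<open>1 - 2 / n\<close> each interval receives at least that many items,
  in which case every item finds a place. An inner area of level \<open>i\<close> then has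
  \<open>O(sqrt (n / 2 ^ i * ln n))\<close> cells.

  Inside an area of \<open>k\<close> cells and width \<open>w\<close> items are placed by a deterministic strategy of cost
  \<open>O(sqrt k * w)\<close>: the first half of the items is sorted into \<open>sqrt k\<close> buckets that claim blocks of
  about \<open>sqrt k / 2\<close> cells on demand, and the free cells that remain form a virtual array on which one
  recurses. The \<open>2 ^ i\<close> areas of level \<open>i\<close> together cost \<open>O((n / 2 ^ i * ln n) powr (1 / 4))\<close>, which
  sums to a geometric series; the leaves cost \<open>O(n powr (1 / 4))\<close>, and the transitions between areas,
  laid out level by level, cost \<open>O(1)\<close> per level.
\<close>

section \<open>Filling blocks on demand\<close>

text \<open>Only lower tails of the counts matter: surplus moves to the parent, and the root is
  exact because all \<open>n\<close> items lie below it. A slack of 2 sqrt(mu ln n) at mean mu makes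
  Chernoff's exponent 2 ln n, so each interval fails with probability at most n^(-2), and there are
  at most 2n intervals. Level \<open>i\<close> has 2^i areas of width 2^(-i), so the widths cancel
  and the level costs as much as the square root of a single area. Stopping at 2^L near sqrt n
  leaves about sqrt n cells per leaf, hence n^(1/4) for all leaves together. Three obstacles lie
  outside this calculation. An online algorithm must be legal on every input, also where the cascade
  overflows; a fallback wrapper repairs this. Strategies obtained by existence proofs need not be
  measurable in the items; rounding to the grid of step 2^(-n) leaves countably many histories, adds
  at most 2 to the cost and respects every dyadic interval in use. Finally a cost bound becomes a
  ratio only if the optimum is bounded below; populated outer quarters give 1/2.\<close>

lemma card_rank:
  fixes X :: "nat set"
  assumes "finite X"
  shows "bij_betw (\<lambda>t. card {u\<in>X. u < t}) X {..<card X}"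
proof -
  have inj: "inj_on (\<lambda>t. card {u\<in>X. u < t}) X"
  proof (rule inj_onI, rule ccontr)
    fix t t' assume *: "t \<in> X" "t' \<in> X" "card {u\<in>X. u < t} = card {u\<in>X. u < t'}" "t \<noteq> t'"
    have aux: "card {u\<in>X. u < a} < card {u\<in>X. u < b}" if "a \<in> X" "a < b" for a b
      using that assms by (intro psubset_card_mono) auto
    from * aux[of t t'] aux[of t' t] show False by (cases t t' rule: linorder_cases) auto
  qed
  have "(\<lambda>t. card {u\<in>X. u < t}) ` X \<subseteq> {..<card X}"
    using assms by (auto intro!: psubset_card_mono)
  moreover have "card ((\<lambda>t. card {u\<in>X. u < t}) ` X) = card {..<card X}"
    using card_image[OF inj] by simp
  ultimately have "(\<lambda>t. card {u\<in>X. u < t}) ` X = {..<card X}"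
    by (intro card_subset_eq) auto
  with inj show ?thesis by (simp add: bij_betw_def)
qed

lemma rank_attained:
  fixes X :: "nat set"
  assumes "finite X" "c < card X"
  obtains t where "t \<in> X" "card {u\<in>X. u < t} = c"
proof -
  have "c \<in> (\<lambda>t. card {u\<in>X. u < t}) ` X"
    using card_rank[OF assms(1)] assms(2) by (simp add: bij_betw_def)
  with that show ?thesis by blast
qed

definition bucket_rank :: "(real \<Rightarrow> nat) \<Rightarrow> real list \<Rightarrow> nat \<Rightarrow> nat" where
  "bucket_rank bk ys t = card {u. u < t \<and> bk (ys ! u) = bk (ys ! t)}"

text \<open>A bucket claims a fresh block whenever its current one has received \<open>b\<close>
  items; the second component numbers the blocks of one bucket.\<close>

definition block_label :: "(real \<Rightarrow> nat) \<Rightarrow> nat \<Rightarrow> real list \<Rightarrow> nat \<Rightarrow> nat \<times> nat" where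
  "block_label bk b ys t = (bk (ys ! t), bucket_rank bk ys t div b)"

text \<open>Blocks are opened on demand, so a block is numbered by the rank of its label in order of first
  appearance.\<close>

definition block_index :: "(real \<Rightarrow> nat) \<Rightarrow> nat \<Rightarrow> real list \<Rightarrow> nat \<Rightarrow> nat" where
  "block_index bk b ys t =
     card (block_label bk b ys ` {u. u < t \<and> (\<forall>v\<le>u. block_label bk b ys v \<noteq> block_label bk b ys t)})"

text \<open>The argument is a history whose last entry is the item being placed, hence the index
  \<open>length ys - 1\<close>.\<close>

definition block_cell :: "(real \<Rightarrow> nat) \<Rightarrow> nat \<Rightarrow> real list \<Rightarrow> nat" where
  "block_cell bk b ys = (let t = length ys - 1 in
     block_index bk b ys t * b + bucket_rank bk ys t mod b)"

lemma block_label_take: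
  assumes "v \<le> t" "t < length ys"
  shows "block_label bk b (take (Suc t) ys) v = block_label bk b ys v"
    and "bucket_rank bk (take (Suc t) ys) v = bucket_rank bk ys v"
proof -
  show "bucket_rank bk (take (Suc t) ys) v = bucket_rank bk ys v"
    unfolding bucket_rank_def using assms by (intro arg_cong[where f = card]) auto
  then show "block_label bk b (take (Suc t) ys) v = block_label bk b ys v"
    unfolding block_label_def using assms by auto
qed

lemma block_cell_take:
  assumes "t < length ys"
  shows "block_cell bk b (take (Suc t) ys) = block_index bk b ys t * b + bucket_rank bk ys t mod b"
proof -
  have len: "length (take (Suc t) ys) - 1 = t" using assms by auto
  have "block_index bk b (take (Suc t) ys) t = block_index bk b ys t"
    unfolding block_index_def using assms
    by (intro arg_cong[where f = card] image_cong) (auto simp: block_label_take)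
  then show ?thesis
    unfolding block_cell_def Let_def len using assms by (simp add: block_label_take)
qed

text \<open>The index counts the distinct labels seen before the first appearance of the given
  label. A later first appearance sees all of these and, in addition, the earlier label
  itself.\<close>

lemma block_index_strict_mono_first:
  assumes "block_label bk b ys t \<noteq> block_label bk b ys u"
    and "(LEAST v. block_label bk b ys v = block_label bk b ys t) <
         (LEAST v. block_label bk b ys v = block_label bk b ys u)" (is "?ft < ?fu")
  shows "block_index bk b ys t < block_index bk b ys u"
proof -
  let ?l = "block_label bk b ys"
  have eq: "{w. w < x \<and> (\<forall>v\<le>w. ?l v \<noteq> ?l x)} = {..<LEAST v. ?l v = ?l x}" for x
  proof (intro set_eqI iffI)
    fix w assume w: "w \<in> {w. w < x \<and> (\<forall>v\<le>w. ?l v \<noteq> ?l x)}"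
    have "?l (LEAST v. ?l v = ?l x) = ?l x" by (rule LeastI[of _ x]) simp
    with w show "w \<in> {..<LEAST v. ?l v = ?l x}" by (metis (mono_tags, lifting) lessThan_iff linorder_not_le mem_Collect_eq)
  next
    fix w assume w: "w \<in> {..<LEAST v. ?l v = ?l x}"
    have "(LEAST v. ?l v = ?l x) \<le> x" by (rule Least_le) simp
    with w show "w \<in> {w. w < x \<and> (\<forall>v\<le>w. ?l v \<noteq> ?l x)}"
      by (auto dest!: le_less_trans dest: not_less_Least)
  qed
  have ft: "?l ?ft = ?l t" by (rule LeastI[of _ t]) simp
  have "?l t \<notin> ?l ` {..<?ft}" by (auto dest: not_less_Least)
  moreover have "?l t \<in> ?l ` {..<?fu}" using ft assms(2) by (metis imageI lessThan_iff)
  moreover have "?l ` {..<?ft} \<subseteq> ?l ` {..<?fu}" using assms(2) by (intro image_mono) auto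
  ultimately show ?thesis
    unfolding block_index_def eq by (intro psubset_card_mono) auto
qed

lemma block_index_inject:
  "block_index bk b ys t = block_index bk b ys u \<longleftrightarrow> block_label bk b ys t = block_label bk b ys u"
    (is "?I t = ?I u \<longleftrightarrow> ?l t = ?l u")
proof
  assume "?l t = ?l u"
  moreover have eq: "{w. w < x \<and> (\<forall>v\<le>w. ?l v \<noteq> ?l x)} = {w. \<forall>v\<le>w. ?l v \<noteq> ?l x}" for x
    using not_le by blast
  ultimately show "?I t = ?I u" unfolding block_index_def eq by simp
next
  assume eq: "?I t = ?I u"
  show "?l t = ?l u"
  proof (rule ccontr)
    assume ne: "?l t \<noteq> ?l u"
    let ?f = "\<lambda>t. LEAST v. ?l v = ?l t"
    have "?l (?f x) = ?l x" for x by (rule LeastI[of _ x]) simp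
    with ne have "?f t \<noteq> ?f u" by metis
    then consider "?f t < ?f u" | "?f u < ?f t" by linarith
    then show False
      using block_index_strict_mono_first[of bk b ys t u] block_index_strict_mono_first[of bk b ys u t] ne eq
      by cases auto
  qed
qed

text \<open>A bucket with \<open>c j\<close> items opens at most \<open>c j div b + 1\<close>
  blocks, so at most one block per bucket is wasted: \<open>s * b\<close> cells in total.\<close>

lemma card_block_labels:
  assumes "b > 0" and bk: "\<And>y. bk y < s"
  shows "card (block_label bk b ys ` {..<h}) * b \<le> h + s * b"
proof -
  define c where "c = (\<lambda>j. card {t. t < h \<and> bk (ys ! t) = j})"
  have sub: "block_label bk b ys ` {..<h} \<subseteq> (SIGMA j:{..<s}. {..<(c j + b) div b})"
  proof
    fix z assume "z \<in> block_label bk b ys ` {..<h}"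
    then obtain t where t: "t < h" "z = block_label bk b ys t" by auto
    have "bucket_rank bk ys t \<le> c (bk (ys ! t))"
      unfolding bucket_rank_def c_def using t by (intro card_mono) auto
    then have "bucket_rank bk ys t div b \<le> c (bk (ys ! t)) div b" by (rule div_le_mono)
    then show "z \<in> (SIGMA j:{..<s}. {..<(c j + b) div b})"
      using t bk assms(1) by (auto simp: block_label_def)
  qed
  have "card (block_label bk b ys ` {..<h}) \<le> card (SIGMA j:{..<s}. {..<(c j + b) div b})"
    using sub by (intro card_mono) auto
  also have "\<dots> = (\<Sum>j<s. (c j + b) div b)" by simp
  finally have "card (block_label bk b ys ` {..<h}) * b \<le> (\<Sum>j<s. (c j + b) div b * b)"
    unfolding sum_distrib_right[symmetric] by (rule mult_right_mono) simp
  also have "\<dots> \<le> (\<Sum>j<s. c j + b)" by (intro sum_mono) (simp add: div_times_less_eq_dividend)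
  also have "\<dots> = (\<Sum>j<s. c j) + s * b" by (simp add: sum.distrib)
  also have "(\<Sum>j<s. c j) = card (\<Union>j<s. {t. t < h \<and> bk (ys ! t) = j})"
    unfolding c_def by (subst card_UN_disjoint) auto
  also have "(\<Union>j<s. {t. t < h \<and> bk (ys ! t) = j}) = {..<h}" using bk by auto
  finally show ?thesis by simp
qed

text \<open>The block determines the label, and quotient and remainder together recover the rank,
  which identifies the item within its bucket. The last two facts drive the cost analysis: a block
  serves one bucket only, and its filled cells form an initial segment.\<close>

lemma block_cell_properties:
  fixes ys :: "real list"
  assumes b: "b > 0" and bk: "\<And>y. bk y < s" and cap: "h + s * b \<le> k" and len: "h \<le> length ys"
  defines "P \<equiv> \<lambda>t. block_cell bk b (take (Suc t) ys)"
  shows "inj_on P {..<h}"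
    and "\<And>t. t < h \<Longrightarrow> P t < k"
    and "\<And>t u. t < h \<Longrightarrow> u < h \<Longrightarrow> P t div b = P u div b \<Longrightarrow> bk (ys ! t) = bk (ys ! u)"
    and "\<And>t i. t < h \<Longrightarrow> i < P t \<Longrightarrow> i div b = P t div b \<Longrightarrow> i \<in> P ` {..<h}"
proof -
  let ?l = "block_label bk b ys" and ?I = "block_index bk b ys" and ?r = "bucket_rank bk ys"
  have P: "P t = ?I t * b + ?r t mod b" if "t < h" for t
    unfolding P_def using that len by (simp add: block_cell_take)
  have Pdiv: "P t div b = ?I t" "P t mod b = ?r t mod b" if "t < h" for t
    using P[OF that] b by auto
  have lab: "?l t = ?l u" if "t < h" "u < h" "P t div b = P u div b" for t u
    using that Pdiv block_index_inject[of bk b ys t u] by simp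
  show "bk (ys ! t) = bk (ys ! u)" if "t < h" "u < h" "P t div b = P u div b" for t u
    using lab[OF that] by (simp add: block_label_def)
  show "inj_on P {..<h}"
  proof (rule inj_onI)
    fix t u assume tu: "t \<in> {..<h}" "u \<in> {..<h}" "P t = P u"
    then have l: "?l t = ?l u" using lab[of t u] by simp
    have "?r t mod b = ?r u mod b" using tu Pdiv(2)[of t] Pdiv(2)[of u] by simp
    moreover have "?r t div b = ?r u div b" using l by (simp add: block_label_def)
    ultimately have r: "?r t = ?r u" by (metis div_mult_mod_eq)
    let ?X = "{v. v < h \<and> bk (ys ! v) = bk (ys ! t)}"
    have *: "card {v \<in> ?X. v < w} = ?r w" if "w \<in> ?X" for w
      unfolding bucket_rank_def using that by (intro arg_cong[where f = card]) auto
    have X: "t \<in> ?X" "u \<in> ?X" using tu l by (auto simp: block_label_def)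
    have "card {v \<in> ?X. v < t} = card {v \<in> ?X. v < u}" unfolding *[OF X(1)] *[OF X(2)] by (rule r)
    moreover have "inj_on (\<lambda>t. card {v \<in> ?X. v < t}) ?X"
      by (rule bij_betw_imp_inj_on[OF card_rank]) simp
    ultimately show "t = u" using X by (auto dest: inj_onD)
  qed
  show "P t < k" if t: "t < h" for t
  proof -
    have "?l t \<notin> ?l ` {u. u < t \<and> (\<forall>v\<le>u. ?l v \<noteq> ?l t)}" by auto
    moreover have "?l t \<in> ?l ` {..<h}" using t by auto
    moreover have "?l ` {u. u < t \<and> (\<forall>v\<le>u. ?l v \<noteq> ?l t)} \<subseteq> ?l ` {..<h}" using t by auto
    ultimately have "?l ` {u. u < t \<and> (\<forall>v\<le>u. ?l v \<noteq> ?l t)} \<subset> ?l ` {..<h}" by blast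
    then have "?I t < card (?l ` {..<h})"
      unfolding block_index_def by (intro psubset_card_mono) auto
    then have "(?I t + 1) * b \<le> card (?l ` {..<h}) * b" by (intro mult_right_mono) auto
    also have "\<dots> \<le> k" using card_block_labels[where bk = bk and s = s and ys = ys and h = h, OF b bk] cap by simp
    finally have "?I t * b + b \<le> k" by simp
    moreover have "?r t mod b < b" using b by simp
    ultimately show "P t < k" using P[OF t] by simp
  qed
  show "i \<in> P ` {..<h}" if t: "t < h" and i: "i < P t" "i div b = P t div b" for t i
  proof -
    let ?X = "{v. v < h \<and> bk (ys ! v) = bk (ys ! t)}"
    have *: "card {v \<in> ?X. v < w} = ?r w" if "w \<in> ?X" for w
      unfolding bucket_rank_def using that by (intro arg_cong[where f = card]) auto
    \<comment> \<open>The rank with the quotient of item \<open>t\<close>, hence the same block, but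
      remainder \<open>i mod b\<close>. It is smaller than the rank of \<open>t\<close>, so an
      earlier item of the bucket has it and occupies cell \<open>i\<close>.\<close>
    define c where "c = ?r t div b * b + i mod b"
    have "i mod b < P t mod b" 
      using i by (metis div_mult_mod_eq nat_add_left_cancel_less)
    then have "i mod b < ?r t mod b" using Pdiv t by simp
    then have "c < ?r t" unfolding c_def using div_mult_mod_eq[of "?r t" b] by linarith
    also have "\<dots> < card ?X"
      unfolding bucket_rank_def using t by (intro psubset_card_mono) auto
    finally obtain u where u: "u \<in> ?X" "card {v \<in> ?X. v < u} = c"
      using rank_attained[of ?X c] by auto
    then have ru: "?r u = c" using * by auto
    then have "?l u = ?l t" using u b unfolding block_label_def c_def by simp
    then have "P u = ?I t * b + i mod b"
      using P[of u] u ru block_index_inject[of bk b ys u t] by (simp add: c_def)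
    also have "\<dots> = i" using i Pdiv(1)[OF t] div_mult_mod_eq[of i b] by simp
    finally show ?thesis using u by auto
  qed
qed

section \<open>A deterministic strategy of cost proportional to the square root\<close>

definition variation :: "nat \<Rightarrow> (nat \<Rightarrow> real) \<Rightarrow> real" where
  "variation k A = (\<Sum>i<k - 1. \<bar>A (Suc i) - A i\<bar>)"

text \<open>\<open>f\<close> is an online strategy for exactly \<open>k\<close> items and the cells \<open>0, \<dots>, k - 1\<close>: the item \<open>ys ! t\<close>
  is written into the cell \<open>f (take (Suc t) ys)\<close>. The array \<open>A\<close> is only constrained on these cells.\<close>

definition sorts_in :: "nat \<Rightarrow> real \<Rightarrow> real \<Rightarrow> real \<Rightarrow> (real list \<Rightarrow> nat) \<Rightarrow> bool" where
  "sorts_in k a w c f \<longleftrightarrow> (\<forall>ys. length ys = k \<longrightarrow>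
     inj_on (\<lambda>t. f (take (Suc t) ys)) {..<k} \<and> (\<forall>t<k. f (take (Suc t) ys) < k) \<and>
     (set ys \<subseteq> {a..a + w} \<longrightarrow>
       (\<forall>A. (\<forall>t<k. A (f (take (Suc t) ys)) = ys ! t) \<longrightarrow> variation k A \<le> c)))"

lemma sorts_in_mono:
  assumes "sorts_in k a w c f" "c \<le> c'"
  shows "sorts_in k a w c' f"
  unfolding sorts_in_def
proof (intro allI impI conjI)
  fix ys :: "real list" assume "length ys = k"
  note * = assms(1)[unfolded sorts_in_def, rule_format, OF this]
  show "inj_on (\<lambda>t. f (take (Suc t) ys)) {..<k}" using * by blast
  show "f (take (Suc t) ys) < k" if "t < k" for t using * that by blast
  show "variation k A \<le> c'" if "set ys \<subseteq> {a..a + w}" "\<forall>t<k. A (f (take (Suc t) ys)) = ys ! t" for A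
    using * that assms(2) by (blast intro: order_trans)
qed

text \<open>Neighbouring cells of \<open>F\<close> are consecutive in its sorted enumeration. Hence
  the recursive cost bound for the virtual array of free cells pays for all pairs of free cells that
  are adjacent in the real array.\<close>

lemma sum_adjacent_le_variation:
  fixes F :: "nat set" and A :: "nat \<Rightarrow> real"
  assumes "finite F"
  shows "(\<Sum>i\<in>{i\<in>F. Suc i \<in> F}. \<bar>A (Suc i) - A i\<bar>)
     \<le> variation (card F) (\<lambda>v. A (sorted_list_of_set F ! v))"
proof -
  define xs where "xs = sorted_list_of_set F"
  have len: "length xs = card F" and set: "set xs = F" and srt: "sorted_wrt (<) xs"
    using assms by (auto simp: xs_def)
  define V where "V = {v. v < card F - 1 \<and> xs ! Suc v = Suc (xs ! v)}"
  have sub: "{i\<in>F. Suc i \<in> F} \<subseteq> (!) xs ` V"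
  proof
    fix i assume "i \<in> {i\<in>F. Suc i \<in> F}"
    then obtain v v' where v: "v < card F" "xs ! v = i" and v': "v' < card F" "xs ! v' = Suc i"
      using set len by (metis (no_types, lifting) in_set_conv_nth mem_Collect_eq)
    have "v < v'"
    proof (rule ccontr)
      assume "\<not> v < v'"
      then have "v' = v \<or> v' < v" by auto
      then show False using v v' sorted_wrt_nth_less[OF srt, of v' v] len by auto
    qed
    moreover have "\<not> Suc v < v'"
      using v v' sorted_wrt_nth_less[OF srt, of v "Suc v"] sorted_wrt_nth_less[OF srt, of "Suc v" v'] len by auto
    ultimately have "v' = Suc v" by simp
    then show "i \<in> (!) xs ` V" using v v' by (auto simp: V_def)
  qed
  have fin: "finite V" by (rule finite_subset[of _ "{..<card F}"]) (auto simp: V_def)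
  have inj: "inj_on ((!) xs) V"
    using len by (intro inj_onI) (auto simp: V_def xs_def nth_eq_iff_index_eq)
  have "(\<Sum>i\<in>{i\<in>F. Suc i \<in> F}. \<bar>A (Suc i) - A i\<bar>) \<le> (\<Sum>i\<in>(!) xs ` V. \<bar>A (Suc i) - A i\<bar>)"
    using sub fin by (intro sum_mono2) auto
  also have "\<dots> = (\<Sum>v\<in>V. \<bar>A (Suc (xs ! v)) - A (xs ! v)\<bar>)"
    using inj by (simp add: sum.reindex)
  also have "\<dots> = (\<Sum>v\<in>V. \<bar>A (xs ! Suc v) - A (xs ! v)\<bar>)"
    by (intro sum.cong) (auto simp: V_def)
  also have "\<dots> \<le> (\<Sum>v<card F - 1. \<bar>A (xs ! Suc v) - A (xs ! v)\<bar>)"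
    by (intro sum_mono2) (auto simp: V_def)
  finally show ?thesis by (simp add: variation_def xs_def)
qed

text \<open>The minimum with \<open>s - 1\<close> moves the right end point \<open>u = s\<close>
  into the last bucket.\<close>

lemma clamped_floor_bounds:
  fixes u :: real and s :: nat
  assumes "0 \<le> u" "u \<le> real s" "s > 0"
  shows "real (min (nat \<lfloor>u\<rfloor>) (s - 1)) \<le> u \<and> u \<le> real (min (nat \<lfloor>u\<rfloor>) (s - 1)) + 1"
proof -
  have fl: "real (nat \<lfloor>u\<rfloor>) \<le> u" "u < real (nat \<lfloor>u\<rfloor>) + 1"
    using assms by simp_all
  show ?thesis
  proof (cases "nat \<lfloor>u\<rfloor> \<le> s - 1")
    case True
    then show ?thesis using fl by (simp add: min_def)
  next
    case False
    then have m: "min (nat \<lfloor>u\<rfloor>) (s - 1) = s - 1" and "s \<le> nat \<lfloor>u\<rfloor>" by auto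
    then have "real s \<le> u" using fl by linarith
    then show ?thesis unfolding m using assms by simp
  qed
qed

lemma same_bucket_close:
  fixes a w y z :: real and s :: nat
  defines "bk \<equiv> \<lambda>y. min (nat \<lfloor>(y - a) * real s / w\<rfloor>) (s - 1)"
  assumes "w > 0" "s > 0" "y \<in> {a..a + w}" "z \<in> {a..a + w}" "bk y = bk z"
  shows "\<bar>y - z\<bar> \<le> w / real s"
proof -
  have range: "real (bk x) \<le> (x - a) * real s / w \<and> (x - a) * real s / w \<le> real (bk x) + 1"
    if "x \<in> {a..a + w}" for x
  proof -
    have "0 \<le> (x - a) * real s / w" "(x - a) * real s / w \<le> real s"
      using that assms(2,3) by (auto simp: divide_simps mult.commute)
    then show ?thesis unfolding bk_def using assms(3) by (rule clamped_floor_bounds)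
  qed
  have "\<bar>(y - a) * real s / w - (z - a) * real s / w\<bar> \<le> 1"
    using range[OF assms(4)] range[OF assms(5)] assms(6) by linarith
  also have "(y - a) * real s / w - (z - a) * real s / w = (y - z) * (real s / w)"
    by (simp add: diff_divide_distrib[symmetric] algebra_simps)
  also have "\<bar>(y - z) * (real s / w)\<bar> = \<bar>y - z\<bar> * (real s / w)"
    using assms(2) by (simp add: abs_mult)
  finally show ?thesis using assms(2,3) by (simp add: field_simps)
qed

text \<open>Such a set contains at most one cell per block, and at most \<open>k div b + 1\<close>
  blocks meet the array.\<close>

lemma card_block_boundary:
  assumes "E \<subseteq> {..<k}" "\<And>i j. i \<in> E \<Longrightarrow> j \<in> E \<Longrightarrow> i < j \<Longrightarrow> i div b \<noteq> j div b"
  shows "card E \<le> k div b + 1"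
proof -
  have "inj_on (\<lambda>i. i div b) E"
    by (rule linorder_inj_onI) (use assms(2) in auto)
  moreover have "(\<lambda>i. i div b) ` E \<subseteq> {..k div b}"
    using assms(1) by (auto intro!: div_le_mono)
  ultimately show ?thesis using card_inj_on_le[of "\<lambda>i. i div b" E "{..k div b}"] by simp
qed

text \<open>The first \<open>h\<close> items are written into blocks of \<open>b\<close> cells, each block serving one of \<open>s\<close> buckets;
  the rest is handed to \<open>g\<close>, which regards the cells still free as one contiguous array. An
  adjacent pair of cells is expensive only if it straddles two blocks or the end of the filled
  part of a block.\<close>

lemma sorts_in_step:
  assumes w: "w > 0" and s: "s > 0" and b: "b > 0" and hk: "h \<le> k" and cap: "h + s * b \<le> k"
    and g: "sorts_in (k - h) a w c g"
  shows "\<exists>f. sorts_in k a w (c + real k * w / real s + 2 * (real (k div b) + 1) * w) f"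
proof -
  define bk where "bk = (\<lambda>y. min (nat \<lfloor>(y - a) * real s / w\<rfloor>) (s - 1))"
  have bk: "bk y < s" for y using s by (auto simp: bk_def)
  \<comment> \<open>Only the first \<open>h\<close> items enter this set, so it is already final
    when the first of the later items is placed.\<close>
  define free where "free = (\<lambda>ys. {..<k} - (\<lambda>t. block_cell bk b (take (Suc t) ys)) ` {..<h})"
  define f where "f = (\<lambda>ys. if length ys \<le> h then block_cell bk b ys
     else sorted_list_of_set (free ys) ! g (drop h ys))"
  have "sorts_in k a w (c + real k * w / real s + 2 * (real (k div b) + 1) * w) f"
    unfolding sorts_in_def
  proof (intro allI impI)
    fix ys :: "real list" assume len: "length ys = k"
    define P where "P = (\<lambda>t. block_cell bk b (take (Suc t) ys))"
    define U where "U = P ` {..<h}"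
    define F where "F = {..<k} - U"
    define Q where "Q = (\<lambda>t. f (take (Suc t) ys))"
    define G where "G = (\<lambda>v. g (take (Suc v) (drop h ys)))"
    have hlen: "h \<le> length ys" using hk len by simp
    have P1: "inj_on P {..<h}"
      unfolding P_def by (rule block_cell_properties(1)[OF b bk cap hlen])
    have P2: "P t < k" if "t < h" for t
      unfolding P_def by (rule block_cell_properties(2)[OF b bk cap hlen that])
    have P3: "bk (ys ! t) = bk (ys ! u)" if "t < h" "u < h" "P t div b = P u div b" for t u
      using that(3) unfolding P_def by (rule block_cell_properties(3)[OF b bk cap hlen that(1,2)])
    have P4: "i \<in> P ` {..<h}" if "t < h" "i < P t" "i div b = P t div b" for t i
      using that(2,3) unfolding P_def by (rule block_cell_properties(4)[OF b bk cap hlen that(1)])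
    have Uk: "U \<subseteq> {..<k}" using P2 by (auto simp: U_def)
    have finF: "finite F" by (simp add: F_def)
    have cardF: "card F = k - h"
      unfolding F_def using Uk P1 by (subst card_Diff_subset) (auto simp: U_def card_image finite_subset)
    define e where "e = (\<lambda>v. sorted_list_of_set F ! v)"
    have e_bij: "bij_betw e {..<k - h} F"
      unfolding e_def using finF cardF by (intro bij_betw_nth) auto
    have Q1: "Q t = P t" if "t < h" for t
      using that len hk by (simp add: Q_def f_def P_def)
    have Q2: "Q t = e (G (t - h))" if "h \<le> t" "t < k" for t
    proof -
      have "free (take (Suc t) ys) = F"
        unfolding free_def F_def U_def P_def using that
        by (intro arg_cong2[where f = "(-)"] image_cong) (auto simp: min_def)
      moreover have "drop h (take (Suc t) ys) = take (Suc (t - h)) (drop h ys)"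
        using that by (simp add: drop_take Suc_diff_le)
      ultimately show ?thesis using that len by (simp add: Q_def f_def e_def G_def)
    qed
    have len': "length (drop h ys) = k - h" using len by simp
    have G: "inj_on G {..<k - h}" "\<And>v. v < k - h \<Longrightarrow> G v < k - h"
      "\<And>A. set (drop h ys) \<subseteq> {a..a + w} \<Longrightarrow> (\<And>v. v < k - h \<Longrightarrow> A (G v) = drop h ys ! v) \<Longrightarrow> variation (k - h) A \<le> c"
      using g[unfolded sorts_in_def, rule_format, OF len'] by (auto simp: G_def)
    have Q_U: "Q t \<in> U" if "t < h" for t using that Q1[OF that] by (simp add: U_def)
    have Q_F: "Q t \<in> F" if "h \<le> t" "t < k" for t
      using that Q2[OF that] G(2)[of "t - h"] bij_betwE[OF e_bij] by simp
    have disj: "U \<inter> F = {}" by (auto simp: F_def)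
    have inj: "inj_on Q {..<k}"
    proof (rule inj_onI)
      fix t u assume tu: "t \<in> {..<k}" "u \<in> {..<k}" "Q t = Q u"
      consider "t < h" "u < h" | "h \<le> t" "h \<le> u" | "t < h" "h \<le> u" | "h \<le> t" "u < h" by linarith
      then show "t = u"
      proof cases
        case 1 then show ?thesis using inj_onD[OF P1, of t u] tu Q1[of t] Q1[of u] by simp
      next
        case 2
        then have "e (G (t - h)) = e (G (u - h))" using tu Q2[of t] Q2[of u] by auto
        then have "G (t - h) = G (u - h)"
          using inj_onD[OF bij_betw_imp_inj_on[OF e_bij], of "G (t - h)" "G (u - h)"]
            G(2)[of "t - h"] G(2)[of "u - h"] tu 2 by simp
        then have "t - h = u - h" using inj_onD[OF G(1), of "t - h" "u - h"] tu 2 by simp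
        then show ?thesis using 2 by simp
      next
        case 3 then show ?thesis using Q_U[of t] Q_F[of u] disj tu by auto
      next
        case 4 then show ?thesis using Q_U[of u] Q_F[of t] disj tu by auto
      qed
    qed
    have lt: "Q t < k" if "t < k" for t
      using that Q_U[of t] Q_F[of t] Uk by (cases "t < h") (auto simp: F_def)
    have surj: "Q ` {..<k} = {..<k}"
      using lt inj by (intro card_subset_eq) (auto simp: card_image)
    have cost: "variation k A \<le> c + real k * w / real s + 2 * (real (k div b) + 1) * w"
      if ys: "set ys \<subseteq> {a..a + w}" and A: "\<And>t. t < k \<Longrightarrow> A (Q t) = ys ! t" for A
    proof -
      have Ain: "A i \<in> {a..a + w}" if i: "i < k" for i
      proof -
        have "i \<in> Q ` {..<k}" using surj i by simp
        then obtain t where t: "t < k" "Q t = i" by auto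
        have "ys ! t \<in> set ys" using t len by simp
        then show ?thesis using ys A[OF t(1)] t by auto
      qed
      let ?d = "\<lambda>i. \<bar>A (Suc i) - A i\<bar>"
      have dw: "?d i \<le> w" if "i < k - 1" for i
      proof -
        have "i < k" "Suc i < k" using that by auto
        then show ?thesis using Ain[of i] Ain[of "Suc i"] by (auto simp: abs_le_iff)
      qed
      \<comment> \<open>Pairs in \<open>I1\<close> are charged to \<open>g\<close>, and pairs in
        \<open>I2\<close> lie in one bucket and cost at most \<open>w / s\<close> each. Pairs in
        \<open>E1\<close> cross a block boundary and pairs in \<open>E2\<close> leave the filled
        part of a block; they cost up to \<open>w\<close>, but each kind occurs at most once per
        block.\<close>
      define I1 where "I1 = {i. i < k - 1 \<and> i \<in> F \<and> Suc i \<in> F}"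
      define I2 where "I2 = {i. i < k - 1 \<and> i \<in> U \<and> Suc i \<in> U \<and> i div b = Suc i div b}"
      define E1 where "E1 = {i. i < k - 1 \<and> i div b \<noteq> Suc i div b}"
      define E2 where "E2 = {i. i < k - 1 \<and> i \<in> U \<and> Suc i \<notin> U \<and> i div b = Suc i div b}"
      \<comment> \<open>Rules out a free cell followed by a filled one within the same block;
        without such pairs the four sets are exhaustive.\<close>
      have U_down: "i \<in> U" if "j \<in> U" "i < j" "i div b = j div b" for i j
        using that P4 unfolding U_def by blast
      have cover: "{..<k - 1} \<subseteq> I1 \<union> I2 \<union> (E1 \<union> E2)"
      proof
        fix i assume i: "i \<in> {..<k - 1}"
        then have "i \<in> U \<or> i \<in> F" "Suc i \<in> U \<or> Suc i \<in> F" by (auto simp: F_def)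
        then show "i \<in> I1 \<union> I2 \<union> (E1 \<union> E2)"
          using i U_down[of "Suc i" i] disj by (auto simp: I1_def I2_def E1_def E2_def)
      qed
      have fin: "finite I1" "finite I2" "finite E1" "finite E2"
        by (auto simp: I1_def I2_def E1_def E2_def)
      have sum_Un: "sum ?d (X \<union> Y) \<le> sum ?d X + sum ?d Y" if "finite X" "finite Y" for X Y
      proof -
        have "0 \<le> sum ?d (X \<inter> Y)" by (intro sum_nonneg) simp
        with sum.union_inter[OF that, of ?d] show ?thesis by linarith
      qed
      have "variation k A \<le> sum ?d (I1 \<union> I2 \<union> (E1 \<union> E2))"
        unfolding variation_def using cover fin by (intro sum_mono2) auto
      also have "\<dots> \<le> sum ?d I1 + sum ?d I2 + (sum ?d E1 + sum ?d E2)"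
        using fin by (intro order_trans[OF sum_Un] add_mono sum_Un) auto
      finally have total: "variation k A \<le> sum ?d I1 + sum ?d I2 + (sum ?d E1 + sum ?d E2)" .
      have "sum ?d I1 \<le> (\<Sum>i\<in>{i\<in>F. Suc i \<in> F}. ?d i)"
        using finF by (intro sum_mono2) (auto simp: I1_def)
      also have "\<dots> \<le> variation (k - h) (\<lambda>v. A (e v))"
        using sum_adjacent_le_variation[OF finF, of A] by (simp add: cardF e_def)
      also have "\<dots> \<le> c"
      proof (rule G(3))
        show "set (drop h ys) \<subseteq> {a..a + w}" using ys set_drop_subset[of h ys] by blast
        fix v assume "v < k - h"
        then show "A (e (G v)) = drop h ys ! v" using Q2[of "v + h"] A[of "v + h"] len by (simp add: add.commute)
      qed
      finally have sum_I1: "sum ?d I1 \<le> c" .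
      have "sum ?d I2 \<le> (\<Sum>i\<in>I2. w / real s)"
      proof (rule sum_mono)
        fix i assume "i \<in> I2"
        then have i: "i \<in> U" "Suc i \<in> U" "i div b = Suc i div b" by (auto simp: I2_def)
        then obtain t u where t: "t < h" "i = P t" and u: "u < h" "Suc i = P u"
          unfolding U_def by blast
        have "bk (ys ! u) = bk (ys ! t)" using P3[OF u(1) t(1)] t u i(3) by simp
        moreover have "ys ! t \<in> {a..a + w}" "ys ! u \<in> {a..a + w}"
          using ys t u len hk by (meson less_le_trans nth_mem subsetD)+
        ultimately have "\<bar>ys ! u - ys ! t\<bar> \<le> w / real s"
          using same_bucket_close[OF w s, of "ys ! u" a "ys ! t"] by (simp add: bk_def)
        moreover have "A i = ys ! t" "A (Suc i) = ys ! u"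
          using A[of t] A[of u] t u Q1 hk by auto
        ultimately show "?d i \<le> w / real s" by simp
      qed
      also have "\<dots> \<le> real k * (w / real s)"
      proof -
        have "card I2 \<le> card {..<k}" by (intro card_mono) (auto simp: I2_def)
        then show ?thesis using w by (simp add: mult_right_mono divide_right_mono)
      qed
      finally have sum_I2: "sum ?d I2 \<le> real k * (w / real s)" .
      have sum_E1: "sum ?d E1 \<le> (real (k div b) + 1) * w"
      proof -
        have "card E1 \<le> k div b + 1"
        proof (rule card_block_boundary)
          fix i j assume ij: "i \<in> E1" "j \<in> E1" "i < j"
          then have "i div b \<noteq> Suc i div b" by (simp add: E1_def)
          moreover have "i div b \<le> Suc i div b" by (rule div_le_mono) simp
          ultimately have "i div b < Suc i div b" by linarith
          moreover have "Suc i div b \<le> j div b" using ij by (intro div_le_mono) auto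
          ultimately show "i div b \<noteq> j div b" by simp
        qed (auto simp: E1_def)
        then have "real (card E1) * w \<le> (real (k div b) + 1) * w" using w by (intro mult_right_mono) auto
        moreover have "sum ?d E1 \<le> of_nat (card E1) * w"
          using dw by (intro sum_bounded_above) (auto simp: E1_def)
        ultimately show ?thesis by simp
      qed
      have sum_E2: "sum ?d E2 \<le> (real (k div b) + 1) * w"
      proof -
        have "card E2 \<le> k div b + 1"
        proof (rule card_block_boundary)
          fix i j assume ij: "i \<in> E2" "j \<in> E2" "i < j"
          show "i div b \<noteq> j div b"
          proof
            assume eq: "i div b = j div b"
            have "Suc i \<noteq> j" using ij by (auto simp: E2_def)
            then have "Suc i < j" using ij by simp
            moreover have "Suc i div b = j div b" using ij eq by (auto simp: E2_def)
            ultimately show False using U_down[of j "Suc i"] ij by (auto simp: E2_def)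
          qed
        qed (auto simp: E2_def)
        then have "real (card E2) * w \<le> (real (k div b) + 1) * w" using w by (intro mult_right_mono) auto
        moreover have "sum ?d E2 \<le> of_nat (card E2) * w"
          using dw by (intro sum_bounded_above) (auto simp: E2_def)
        ultimately show ?thesis by simp
      qed
      from total sum_I1 sum_I2 sum_E1 sum_E2 show ?thesis by (simp add: algebra_simps)
    qed
    show "inj_on (\<lambda>t. f (take (Suc t) ys)) {..<k} \<and> (\<forall>t<k. f (take (Suc t) ys) < k) \<and>
     (set ys \<subseteq> {a..a + w} \<longrightarrow>
       (\<forall>A. (\<forall>t<k. A (f (take (Suc t) ys)) = ys ! t) \<longrightarrow>
          variation k A \<le> c + real k * w / real s + 2 * (real (k div b) + 1) * w))"
      using inj lt cost by (auto simp: Q_def)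
  qed
  then show ?thesis by blast
qed

text \<open>With about sqrt k buckets and blocks of about sqrt k / 2 cells, one step costs O(sqrt k)
  w and leaves half the cells, rounded up, to the recursion. Since the bound is proportional to the
  square root of the number of cells, the recursion sums geometrically.\<close>

theorem sqrt_strategy:
  assumes w: "w > 0"
  shows "\<exists>f. sorts_in k a w (100 * sqrt (real k) * w) f"
proof (induction k rule: less_induct)
  case (less k)
  show ?case
  proof (cases "k \<le> 1")
    case True
    have "sorts_in k a w (100 * sqrt (real k) * w) (\<lambda>_. 0)"
      unfolding sorts_in_def using True w by (auto simp: variation_def inj_on_def)
    then show ?thesis by blast
  next
    case False
    define h where "h = k div 2"
    define s where "s = nat \<lfloor>sqrt (real k)\<rfloor>"
    define b where "b = (k - h) div s"
    have k2: "k \<ge> 2" using False by simp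
    have r1: "sqrt (real k) \<ge> 1" using k2 by simp
    have rr: "sqrt (real k) * sqrt (real k) = real k" by simp
    have s_le: "real s \<le> sqrt (real k)" and s_gt: "sqrt (real k) < real s + 1"
      using r1 by (auto simp: s_def of_nat_nat)
    have s1: "s \<ge> 1" using s_gt r1 by linarith
    have s_ge: "sqrt (real k) \<le> 2 * real s" using s_gt s1 by linarith
    have "real (s * s) \<le> real k" using mult_mono[OF s_le s_le] r1 by simp
    then have ss: "s * s \<le> k" by linarith
    have kh: "2 * (k - h) \<ge> k" "4 * (k - h) \<le> 3 * k" "h < k" "h > 0" using k2 by (auto simp: h_def)
    \<comment> \<open>Guarantees that the block length \<open>b\<close> is not 0.\<close>
    have skh: "s \<le> k - h"
    proof (cases "s = 1")
      case True then show ?thesis using kh by linarith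
    next
      case False
      then have "2 * s \<le> s * s" using s1 by simp
      then show ?thesis using ss kh by linarith
    qed
    have b1: "b \<ge> 1" using skh s1 by (simp add: b_def Suc_le_eq div_greater_zero_iff)
    have sb: "s * b \<le> k - h" by (simp add: b_def)
    have "k - h < s * (b + 1)" unfolding b_def
      using s1 dividend_less_times_div[of s "k - h"] by simp
    then have "real k < 2 * (real s * (real b + 1))"
      using kh(1) by (metis (no_types, opaque_lifting) le_less_trans mult_less_cancel1 of_nat_1 of_nat_add of_nat_less_iff of_nat_mult of_nat_numeral zero_less_numeral)
    also have "\<dots> \<le> 2 * (sqrt (real k) * (2 * real b))"
      using s_le b1 r1 by (intro mult_left_mono mult_mono) auto
    finally have "sqrt (real k) * sqrt (real k) < sqrt (real k) * (4 * real b)" using rr by simp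
    then have b_ge: "sqrt (real k) < 4 * real b"
      using r1 by (metis mult_less_cancel_left_pos less_le_trans zero_less_one)
    have kb: "real (k div b) \<le> 4 * sqrt (real k)"
    proof -
      have "real (k div b) \<le> real k / real b" by (rule of_nat_div_le_of_nat)
      also have "\<dots> \<le> 4 * sqrt (real k)"
      proof -
        have "real k \<le> sqrt (real k) * (4 * real b)"
          using mult_left_mono[of "sqrt (real k)" "4 * real b" "sqrt (real k)"] b_ge r1 rr by simp
        then show ?thesis using b1 by (simp add: divide_le_eq mult_ac)
      qed
      finally show ?thesis .
    qed
    have ks: "real k / real s \<le> 2 * sqrt (real k)"
    proof -
      have "real k \<le> sqrt (real k) * (2 * real s)"
        using mult_left_mono[OF s_ge, of "sqrt (real k)"] r1 rr by simp
      then show ?thesis using s1 by (simp add: divide_le_eq mult_ac)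
    qed
    \<comment> \<open>The upper half of \<open>k \<ge> 2\<close> has at most 3k/4 cells, and 0.87
      squared exceeds 3/4.\<close>
    have sq: "sqrt (real (k - h)) \<le> (87/100) * sqrt (real k)"
    proof (rule real_le_lsqrt)
      have "real (k - h) \<le> 3 / 4 * real k" using kh(2) by linarith
      also have "\<dots> \<le> ((87/100) * sqrt (real k))\<^sup>2" by (simp add: power_mult_distrib power2_eq_square)
      finally show "real (k - h) \<le> ((87/100) * sqrt (real k))\<^sup>2" .
    qed (use r1 in auto)
    obtain g where g: "sorts_in (k - h) a w (100 * sqrt (real (k - h)) * w) g"
      using less.IH[of "k - h"] kh by auto
    obtain f where f: "sorts_in k a w (100 * sqrt (real (k - h)) * w + real k * w / real s + 2 * (real (k div b) + 1) * w) f"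
      using sorts_in_step[OF w _ _ _ _ g, of s b] s1 b1 sb kh
      by (metis Nat.le_diff_conv2 add.commute less_eq_Suc_le One_nat_def less_imp_le)
    have "100 * sqrt (real (k - h)) * w + real k * w / real s + 2 * (real (k div b) + 1) * w
      = (100 * sqrt (real (k - h)) + real k / real s + 2 * (real (k div b) + 1)) * w"
      by (simp add: algebra_simps)
    also have "\<dots> \<le> (100 * sqrt (real k)) * w"
    proof (rule mult_right_mono)
      \<comment> \<open>The coefficients add up to 87 + 2 + 8 + 2 = 99, where the last 2 uses
        \<open>1 \<le> z\<close>.\<close>
      have "100 * p + q + 2 * (r + 1) \<le> 100 * z"
        if "p \<le> 87/100 * z" "q \<le> 2 * z" "r \<le> 4 * z" "1 \<le> z" for p q r z :: real
        using that by (simp add: field_simps)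
      from this[OF sq ks kb r1]
      show "100 * sqrt (real (k - h)) + real k / real s + 2 * (real (k div b) + 1) \<le> 100 * sqrt (real k)" .
    qed (use w in simp)
    finally have "sorts_in k a w (100 * sqrt (real k) * w) f"
      using f by (rule sorts_in_mono[rotated])
    then show ?thesis by blast
  qed
qed

section \<open>The dyadic cascade\<close>

lemma variation_Suc_Suc: "variation (Suc (Suc k)) A = variation (Suc k) A + \<bar>A (Suc k) - A k\<bar>"
  by (simp add: variation_def)

lemma variation_append:
  assumes "D \<ge> 0" and "m > 0 \<Longrightarrow> m' > 0 \<Longrightarrow> \<bar>A m - A (m - 1)\<bar> \<le> D"
  shows "variation (m + m') A \<le> variation m A + variation m' (\<lambda>i. A (m + i)) + D"
proof (cases "m = 0 \<or> m' = 0")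
  case True
  then show ?thesis using assms(1) by (auto simp: variation_def)
next
  case False
  then obtain p q where pq: "m = Suc p" "m' = Suc q" by (metis not0_implies_Suc)
  have "variation (Suc p + Suc q) A =
    variation (Suc p) A + variation (Suc q) (\<lambda>i. A (Suc p + i)) + \<bar>A (Suc p) - A p\<bar>" for q
  proof (induction q)
    case 0
    then show ?case using variation_Suc_Suc[of p A] by (simp add: variation_def)
  next
    case (Suc q)
    have "variation (Suc p + Suc (Suc q)) A = variation (Suc p + Suc q) A + \<bar>A (Suc p + Suc q) - A (Suc p + q)\<bar>"
      using variation_Suc_Suc[of "Suc p + q" A] by simp
    moreover have "variation (Suc (Suc q)) (\<lambda>i. A (Suc p + i)) =
      variation (Suc q) (\<lambda>i. A (Suc p + i)) + \<bar>A (Suc p + Suc q) - A (Suc p + q)\<bar>"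
      by (rule variation_Suc_Suc)
    ultimately show ?case using Suc.IH by linarith
  qed
  from this[of q] show ?thesis using assms(2) pq by simp
qed

text \<open>Serves the areas within one level: only the jumps at the seams need a bound, and it can
  be of the order of the interval width.\<close>

lemma variation_equal_blocks:
  assumes "D \<ge> 0"
    and "\<And>j. 0 < j \<Longrightarrow> j < m \<Longrightarrow> c > 0 \<Longrightarrow> \<bar>A (j * c) - A (j * c - 1)\<bar> \<le> D"
  shows "variation (m * c) A \<le> (\<Sum>j<m. variation c (\<lambda>l. A (j * c + l))) + real m * D"
  using assms(2)
proof (induction m)
  case 0
  then show ?case by (simp add: variation_def)
next
  case (Suc m)
  have "variation (m * c + c) A \<le> variation (m * c) A + variation c (\<lambda>i. A (m * c + i)) + D"
    using Suc.prems[of m] assms(1) by (intro variation_append) auto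
  moreover have "variation (m * c) A \<le> (\<Sum>j<m. variation c (\<lambda>l. A (j * c + l))) + real m * D"
    using Suc.prems by (intro Suc.IH) auto
  ultimately show ?case by (simp add: algebra_simps)
qed

text \<open>Serves the passage between levels, whose sizes differ and whose ends hold unrelated
  values; therefore \<open>D\<close> bounds the spread of the whole array.\<close>

lemma variation_blocks:
  fixes m :: "nat \<Rightarrow> nat"
  assumes "D \<ge> 0"
    and "\<And>i i'. i < (\<Sum>d<k. m d) \<Longrightarrow> i' < (\<Sum>d<k. m d) \<Longrightarrow> \<bar>A i - A i'\<bar> \<le> D"
  shows "variation (\<Sum>d<k. m d) A \<le> (\<Sum>d<k. variation (m d) (\<lambda>i. A ((\<Sum>d'<d. m d') + i)) + D)"
  using assms(2)
proof (induction k)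
  case 0
  then show ?case by (simp add: variation_def)
next
  case (Suc k)
  have "variation ((\<Sum>d<k. m d) + m k) A \<le>
      variation (\<Sum>d<k. m d) A + variation (m k) (\<lambda>i. A ((\<Sum>d<k. m d) + i)) + D"
    using Suc.prems assms(1) by (intro variation_append) auto
  moreover have "variation (\<Sum>d<k. m d) A \<le> (\<Sum>d<k. variation (m d) (\<lambda>i. A ((\<Sum>d'<d. m d') + i)) + D)"
    using Suc.prems by (intro Suc.IH) auto
  ultimately show ?case by simp
qed

section \<open>Arrivals and overflow at the stages of the cascade\<close>

lemma card_rank_ge:
  fixes X :: "nat set"
  assumes "finite X"
  shows "card {t\<in>X. c \<le> card {u\<in>X. u < t}} = card X - c"
proof -
  let ?r = "\<lambda>t. card {u\<in>X. u < t}"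
  have bij: "inj_on ?r X" "?r ` X = {..<card X}"
    using card_rank[OF assms] by (auto simp: bij_betw_def)
  have "?r ` {t\<in>X. c \<le> ?r t} = {c..<card X}"
  proof (intro set_eqI iffI)
    fix v assume "v \<in> {c..<card X}"
    then have "v \<in> ?r ` X" "c \<le> v" using bij(2) by auto
    then show "v \<in> ?r ` {t\<in>X. c \<le> ?r t}" by auto
  next
    fix v assume "v \<in> ?r ` {t\<in>X. c \<le> ?r t}"
    then have "v \<in> ?r ` X" "c \<le> v" by auto
    then show "v \<in> {c..<card X}" using bij(2) by auto
  qed
  then have "card (?r ` {t\<in>X. c \<le> ?r t}) = card X - c" by simp
  moreover have "inj_on ?r {t\<in>X. c \<le> ?r t}" using bij(1) by (rule inj_on_subset) auto
  ultimately show ?thesis by (simp add: card_image)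
qed

lemma filter_upt_split:
  assumes "t < n" "P t"
  shows "filter P [0..<n] = filter P [0..<t] @ t # filter P [Suc t..<n]"
proof -
  have "[0..<n] = [0..<t] @ [t..<n]"
    using upt_add_eq_append[of 0 t "n - t"] assms(1) by simp
  also have "[t..<n] = t # [Suc t..<n]" using assms(1) by (simp add: upt_conv_Cons)
  finally have "filter P [0..<n] = filter P ([0..<t] @ t # [Suc t..<n])" by simp
  then show ?thesis using assms(2) by simp
qed

text \<open>At stage \<open>d\<close> every class \<open>j\<close> of \<open>K d\<close> owns an area of \<open>cap d\<close> cells. An item arrives at stage
  \<open>Suc d\<close> iff the areas of its classes at the stages \<open>0, \<dots>, d\<close> are full when it comes.\<close>

primrec arrives :: "(nat \<Rightarrow> real \<Rightarrow> nat) \<Rightarrow> (nat \<Rightarrow> nat) \<Rightarrow> (nat \<Rightarrow> real) \<Rightarrow> nat \<Rightarrow> nat \<Rightarrow> bool" where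
  "arrives K cap y 0 = (\<lambda>t. True)"
| "arrives K cap y (Suc d) = (\<lambda>t. arrives K cap y d t \<and>
     cap d \<le> card {u. u < t \<and> arrives K cap y d u \<and> K d (y u) = K d (y t)})"

definition arrival_rank :: "(nat \<Rightarrow> real \<Rightarrow> nat) \<Rightarrow> (nat \<Rightarrow> nat) \<Rightarrow> (nat \<Rightarrow> real) \<Rightarrow> nat \<Rightarrow> nat \<Rightarrow> nat" where
  "arrival_rank K cap y d t = card {u. u < t \<and> arrives K cap y d u \<and> K d (y u) = K d (y t)}"

text \<open>The item stays at the first stage whose area has room. That this stage is at most
  \<open>L\<close> is not built in; it is derived from \<open>enough\<close>.\<close>

definition stage :: "(nat \<Rightarrow> real \<Rightarrow> nat) \<Rightarrow> (nat \<Rightarrow> nat) \<Rightarrow> (nat \<Rightarrow> real) \<Rightarrow> nat \<Rightarrow> nat" where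
  "stage K cap y t = (LEAST d. arrival_rank K cap y d t < cap d)"

lemma arrives_iff: "arrives K cap y d t \<longleftrightarrow> (\<forall>d'<d. cap d' \<le> arrival_rank K cap y d' t)"
  by (induction d) (auto simp: arrival_rank_def less_Suc_eq)

text \<open>This is where the cascade is seen to be online: whether item \<open>t\<close> reaches a
  stage is determined by the items up to \<open>t\<close>, so it can be recomputed from the
  history.\<close>

lemma arrives_cong:
  assumes "\<And>u. u \<le> t \<Longrightarrow> y u = y' u"
  shows "arrives K cap y d t = arrives K cap y' d t"
  using assms
proof (induction d arbitrary: t)
  case (Suc d)
  have "{u. u < t \<and> arrives K cap y d u \<and> K d (y u) = K d (y t)} =
        {u. u < t \<and> arrives K cap y' d u \<and> K d (y' u) = K d (y' t)}"
    using Suc.IH Suc.prems by auto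
  then show ?case using Suc.IH[of t] Suc.prems by simp
qed simp

lemma arrival_rank_cong:
  assumes "\<And>u. u \<le> t \<Longrightarrow> y u = y' u"
  shows "arrival_rank K cap y d t = arrival_rank K cap y' d t"
proof -
  have "arrives K cap y d u = arrives K cap y' d u" if "u < t" for u
    using that assms by (intro arrives_cong) auto
  then show ?thesis unfolding arrival_rank_def using assms
    by (intro arg_cong[where f = card]) auto
qed

lemma stage_cong:
  assumes "\<And>u. u \<le> t \<Longrightarrow> y u = y' u"
  shows "stage K cap y t = stage K cap y' t"
  unfolding stage_def using arrival_rank_cong[OF assms] by simp

text \<open>Kept as a list in order of time because its values form the history on which the local
  strategy of the area is run.\<close>

definition arrivals :: "(nat \<Rightarrow> real \<Rightarrow> nat) \<Rightarrow> (nat \<Rightarrow> nat) \<Rightarrow> (nat \<Rightarrow> real) \<Rightarrow> nat \<Rightarrow> nat \<Rightarrow> nat \<Rightarrow> nat list" where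
  "arrivals K cap y d j m = filter (\<lambda>u. arrives K cap y d u \<and> K d (y u) = j) [0..<m]"

lemma length_arrivals:
  "length (arrivals K cap y d j m) = card {u. u < m \<and> arrives K cap y d u \<and> K d (y u) = j}"
  unfolding arrivals_def by (subst distinct_card[symmetric]) (auto intro!: arg_cong[where f = card])

lemma length_arrivals_rank: "length (arrivals K cap y d (K d (y t)) t) = arrival_rank K cap y d t"
  by (simp add: length_arrivals arrival_rank_def)

text \<open>Stage \<open>d\<close> is the level \<open>L - d\<close> of the dyadic tree, and \<open>S d\<close> is the number of cells owned by
  a node of stage \<open>d\<close> together with its descendants.\<close>

locale dyadic_cascade =
  fixes K :: "nat \<Rightarrow> real \<Rightarrow> nat" and cap S :: "nat \<Rightarrow> nat" and L n :: nat
  assumes K_less: "\<And>d y. d \<le> L \<Longrightarrow> K d y < 2 ^ (L - d)"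
    and K_Suc: "\<And>d y. d < L \<Longrightarrow> K (Suc d) y = K d y div 2"
    and S_0: "S 0 = cap 0"
    and S_Suc: "\<And>d. d < L \<Longrightarrow> S (Suc d) = 2 * S d + cap (Suc d)"
    and S_L: "S L = n"
begin

abbreviation "rk \<equiv> arrival_rank K cap"

definition enough :: "(nat \<Rightarrow> real) \<Rightarrow> bool" where
  "enough y \<longleftrightarrow> (\<forall>d\<le>L. \<forall>j<2 ^ (L - d). S d \<le> card {t. t < n \<and> K d (y t) = j})"

text \<open>If every node receives at least as many items as its subtree has cells, then the subtree is
  filled completely and passes exactly the surplus to the parent.\<close>

lemma card_arrivals:
  assumes "enough y" "d \<le> L" "j < 2 ^ (L - d)"
  shows "length (arrivals K cap y d j n) + S d = card {t. t < n \<and> K d (y t) = j} + cap d"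
  using assms(2,3)
proof (induction d arbitrary: j)
  case 0
  then show ?case by (simp add: length_arrivals S_0)
next
  case (Suc d)
  define X where "X = (\<lambda>i. {u. u < n \<and> arrives K cap y d u \<and> K d (y u) = i})"
  \<comment> \<open>The overflow of node \<open>i\<close> of stage \<open>d\<close>. The arrivals at
    the parent \<open>j\<close> are the overflows of its children \<open>2 * j\<close> and
    \<open>2 * j + 1\<close>.\<close>
  define Y where "Y = (\<lambda>i. {t \<in> X i. cap d \<le> card {u \<in> X i. u < t}})"
  have fin: "finite (X i)" for i by (simp add: X_def)
  have d: "d < L" "d \<le> L" using Suc.prems by auto
  have pow: "2 * j < 2 ^ (L - d)" "Suc (2 * j) < 2 ^ (L - d)"
  proof -
    have "L - d = Suc (L - Suc d)" using d by simp
    then have "(2::nat) ^ (L - d) = 2 * 2 ^ (L - Suc d)" by simp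
    then show "2 * j < 2 ^ (L - d)" "Suc (2 * j) < 2 ^ (L - d)" using Suc.prems by linarith+
  qed
  have cardY: "card (Y i) + S d = card {t. t < n \<and> K d (y t) = i}" if "i < 2 ^ (L - d)" for i
  proof -
    have "card (X i) + S d = card {t. t < n \<and> K d (y t) = i} + cap d"
      using Suc.IH[OF d(2) that] by (simp add: length_arrivals X_def)
    moreover have "S d \<le> card {t. t < n \<and> K d (y t) = i}"
      using assms(1) d(2) that by (auto simp: enough_def)
    moreover have "card (Y i) = card (X i) - cap d" unfolding Y_def by (rule card_rank_ge[OF fin])
    ultimately show ?thesis by linarith
  qed
  have half: "K (Suc d) z = j \<longleftrightarrow> K d z = 2 * j \<or> K d z = Suc (2 * j)" for z
    unfolding K_Suc[OF d(1)] by linarith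
  have YX: "{u. u < n \<and> arrives K cap y (Suc d) u \<and> K d (y u) = i} = Y i" for i
  proof -
    have "{u \<in> X i. u < t} = {u. u < t \<and> arrives K cap y d u \<and> K d (y u) = i}" if "t < n" for t
      using that by (auto simp: X_def)
    then show ?thesis unfolding Y_def by (auto simp: X_def)
  qed
  have "{u. u < n \<and> arrives K cap y (Suc d) u \<and> K (Suc d) (y u) = j} = Y (2 * j) \<union> Y (Suc (2 * j))"
    unfolding YX[symmetric] half by blast
  moreover have "Y (2 * j) \<inter> Y (Suc (2 * j)) = {}" by (auto simp: Y_def X_def)
  ultimately have "length (arrivals K cap y (Suc d) j n) = card (Y (2 * j)) + card (Y (Suc (2 * j)))"
    unfolding length_arrivals using fin by (subst card_Un_disjoint[symmetric]) (auto simp: Y_def)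
  moreover have "card {t. t < n \<and> K (Suc d) (y t) = j} =
     card {t. t < n \<and> K d (y t) = 2 * j} + card {t. t < n \<and> K d (y t) = Suc (2 * j)}"
  proof -
    have "{t. t < n \<and> K (Suc d) (y t) = j} = {t. t < n \<and> K d (y t) = 2 * j} \<union> {t. t < n \<and> K d (y t) = Suc (2 * j)}"
      unfolding half by blast
    then show ?thesis by (simp add: card_Un_disjoint disjoint_iff)
  qed
  ultimately show ?case
    using cardY[OF pow(1)] cardY[OF pow(2)] S_Suc[OF d(1)] by linarith
qed

text \<open>At the root, \<open>card_arrivals\<close> and \<open>S L = n\<close> yield exactly
  \<open>cap L\<close> arrivals. An item that found every area full would itself arrive at the root
  with a rank below \<open>cap L\<close>, which contradicts the root area being full for it.\<close>

lemma stage_properties: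
  assumes "enough y" "t < n"
  shows "stage K cap y t \<le> L" "rk y (stage K cap y t) t < cap (stage K cap y t)"
    "arrives K cap y (stage K cap y t) t"
proof -
  have ex: "\<exists>d\<le>L. rk y d t < cap d"
  proof (rule ccontr)
    assume "\<not> (\<exists>d\<le>L. rk y d t < cap d)"
    then have *: "cap d \<le> rk y d t" if "d \<le> L" for d using that by auto
    then have arr: "arrives K cap y L t" by (simp add: arrives_iff)
    have K0: "K L z = 0" for z using K_less[of L z] by simp
    have "rk y L t < card {u. u < n \<and> arrives K cap y L u \<and> K L (y u) = 0}"
      unfolding arrival_rank_def using assms(2) arr K0 by (intro psubset_card_mono) auto
    also have "\<dots> = cap L"
      using card_arrivals[OF assms(1), of L 0] K0 S_L by (simp add: length_arrivals)
    finally show False using *[of L] by simp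
  qed
  then obtain d where d: "d \<le> L" "rk y d t < cap d" by auto
  show "stage K cap y t \<le> L" unfolding stage_def using Least_le[of "\<lambda>d. rk y d t < cap d" d] d by linarith
  show "rk y (stage K cap y t) t < cap (stage K cap y t)"
    unfolding stage_def by (rule LeastI[of "\<lambda>d. rk y d t < cap d" d]) (rule d)
  show "arrives K cap y (stage K cap y t) t"
    unfolding arrives_iff stage_def by (auto dest!: not_less_Least)
qed

lemma stage_eqI:
  assumes "arrives K cap y d t" "rk y d t < cap d"
  shows "stage K cap y t = d"
  unfolding stage_def using assms
  by (intro Least_equality) (auto simp: arrives_iff intro: leI)

text \<open>Levels are laid out from the leaves to the root; this is the first cell of stage
  \<open>d\<close>.\<close>

definition base :: "nat \<Rightarrow> nat" where
  "base d = (\<Sum>d'<d. 2 ^ (L - d') * cap d')"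

lemma base_Suc: "base (Suc d) = base d + 2 ^ (L - d) * cap d"
  by (simp add: base_def)

lemma base_total: "base (Suc L) = n"
proof -
  \<comment> \<open>The stages up to \<open>d\<close> together consist of the subtrees of the nodes
    of stage \<open>d\<close>.\<close>
  have "d \<le> L \<Longrightarrow> base (Suc d) = 2 ^ (L - d) * S d" for d
  proof (induction d)
    case 0
    then show ?case by (simp add: base_def S_0)
  next
    case (Suc d)
    have "L - d = Suc (L - Suc d)" using Suc.prems by simp
    then have "base (Suc d) = 2 * 2 ^ (L - Suc d) * S d" using Suc by simp
    then show ?case using Suc.prems S_Suc[of d] by (simp add: base_Suc[of "Suc d"] algebra_simps)
  qed
  from this[of L] show ?thesis using S_L by simp
qed

lemma base_mono: "d \<le> d' \<Longrightarrow> base d \<le> base d'"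
  unfolding base_def by (rule sum_mono2) auto

text \<open>The address is the start of the stage, plus the offset of the area, plus the cell chosen
  by the local strategy \<open>f d j\<close>, which sees only the items that have arrived at its own
  node.\<close>

definition cascade_cell :: "(nat \<Rightarrow> nat \<Rightarrow> real list \<Rightarrow> nat) \<Rightarrow> real list \<Rightarrow> nat" where
  "cascade_cell f h = (let t = length h - 1; d = stage K cap ((!) h) t; j = K d (h ! t) in
     base d + j * cap d + f d j (map ((!) h) (arrivals K cap ((!) h) d j (Suc t))))"

lemma cascade_cell_take:
  assumes "t < length ys"
  defines "d \<equiv> stage K cap ((!) ys) t"
  defines "j \<equiv> K d (ys ! t)"
  shows "cascade_cell f (take (Suc t) ys) =
    base d + j * cap d + f d j (map ((!) ys) (arrivals K cap ((!) ys) d j (Suc t)))"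
proof -
  let ?h = "take (Suc t) ys"
  have len: "length ?h - 1 = t" using assms(1) by simp
  have eq: "?h ! u = ys ! u" if "u \<le> t" for u using that by simp
  have st: "stage K cap ((!) ?h) t = d" unfolding d_def by (rule stage_cong) (simp add: eq)
  have arr: "arrivals K cap ((!) ?h) d j (Suc t) = arrivals K cap ((!) ys) d j (Suc t)"
    unfolding arrivals_def
  proof (rule filter_cong[OF refl])
    fix u assume "u \<in> set [0..<Suc t]"
    then have u: "u \<le> t" by auto
    have "arrives K cap ((!) ?h) d u = arrives K cap ((!) ys) d u"
      using u by (intro arrives_cong) (simp add: eq)
    then show "(arrives K cap ((!) ?h) d u \<and> K d (?h ! u) = j) = (arrives K cap ((!) ys) d u \<and> K d (ys ! u) = j)"
      using u by (simp add: eq)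
  qed
  have mp: "map ((!) ?h) (arrivals K cap ((!) ys) d j (Suc t)) = map ((!) ys) (arrivals K cap ((!) ys) d j (Suc t))"
    by (rule map_cong[OF refl]) (auto simp: arrivals_def simp del: upt_Suc)
  show ?thesis
    unfolding cascade_cell_def Let_def len st eq[OF order_refl] j_def[symmetric] arr mp by (rule refl)
qed

text \<open>An item's rank is its position in the list of arrivals, so the local history at the time
  of its placement is a prefix of the complete list.\<close>

lemma nth_arrivals:
  assumes "t < n" "arrives K cap y d t"
  shows "arrivals K cap y d (K d (y t)) n ! rk y d t = t"
    and "take (Suc (rk y d t)) (arrivals K cap y d (K d (y t)) n) = arrivals K cap y d (K d (y t)) (Suc t)"
    and "rk y d t < length (arrivals K cap y d (K d (y t)) n)"
proof -
  let ?xs = "arrivals K cap y d (K d (y t))"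
  have split: "?xs n = ?xs t @ t # filter (\<lambda>u. arrives K cap y d u \<and> K d (y u) = K d (y t)) [Suc t..<n]"
    unfolding arrivals_def using assms by (intro filter_upt_split) auto
  have len: "length (?xs t) = rk y d t" by (rule length_arrivals_rank)
  have "?xs (Suc t) = ?xs t @ [t]" using assms by (simp add: arrivals_def)
  then show "take (Suc (rk y d t)) (?xs n) = ?xs (Suc t)"
    unfolding split using len by simp
  show "?xs n ! rk y d t = t" unfolding split using len by (simp add: nth_append)
  show "rk y d t < length (?xs n)" unfolding split using len by simp
qed

lemma arrivals_nth:
  assumes "r < length (arrivals K cap y d j n)"
  defines "t \<equiv> arrivals K cap y d j n ! r"
  shows "t < n" "arrives K cap y d t" "K d (y t) = j" "rk y d t = r"
proof -
  have "t \<in> set (arrivals K cap y d j n)" unfolding t_def using assms(1) by (rule nth_mem)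
  then show t: "t < n" "arrives K cap y d t" "K d (y t) = j" by (auto simp: arrivals_def)
  have "distinct (arrivals K cap y d j n)" by (simp add: arrivals_def)
  then show "rk y d t = r"
    using nth_arrivals(1,3)[OF t(1,2)] t(3) assms(1) nth_eq_iff_index_eq[of "arrivals K cap y d j n" "rk y d t" r]
    by (simp add: t_def)
qed

section \<open>The cascade on a fixed input with enough items in every interval\<close>

context
  fixes f :: "nat \<Rightarrow> nat \<Rightarrow> real list \<Rightarrow> nat" and ys :: "real list"
  assumes f: "\<And>d j. d \<le> L \<Longrightarrow> sorts_in (cap d) (real j / 2 ^ (L - d)) (1 / 2 ^ (L - d))
      (100 * sqrt (real (cap d)) * (1 / 2 ^ (L - d))) (f d j)"
    and K_mem: "\<And>d y. d \<le> L \<Longrightarrow> y \<in> {0..1} \<Longrightarrow>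
      y \<in> {real (K d y) / 2 ^ (L - d)..real (K d y) / 2 ^ (L - d) + 1 / 2 ^ (L - d)}"
    and ys_len: "length ys = n" and ys_mem: "set ys \<subseteq> {0..1}" and ys_enough: "enough ((!) ys)"
begin

abbreviation "cell t \<equiv> cascade_cell f (take (Suc t) ys)"
abbreviation "area d j \<equiv> arrivals K cap ((!) ys) d j n"

text \<open>\<open>sorts_in\<close> speaks about complete inputs of length \<open>cap d\<close>
  only. Every local history is a prefix of this list, which has exactly that length.\<close>

definition accepted :: "nat \<Rightarrow> nat \<Rightarrow> real list" where
  "accepted d j = take (cap d) (map ((!) ys) (area d j))"

lemma area_ge:
  assumes "d \<le> L" "j < 2 ^ (L - d)"
  shows "cap d \<le> length (area d j)"
proof -
  have "S d \<le> card {t. t < n \<and> K d (ys ! t) = j}" using ys_enough assms by (auto simp: enough_def)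
  then show ?thesis using card_arrivals[OF ys_enough assms] by linarith
qed

lemma length_accepted: "d \<le> L \<Longrightarrow> j < 2 ^ (L - d) \<Longrightarrow> length (accepted d j) = cap d"
  using area_ge by (simp add: accepted_def)

lemma cell_eq:
  assumes "t < n" "d = stage K cap ((!) ys) t" "j = K d (ys ! t)" "r = rk ((!) ys) d t"
  shows "cell t = base d + j * cap d + f d j (take (Suc r) (accepted d j))"
    and "d \<le> L" "j < 2 ^ (L - d)" "r < cap d" "t = area d j ! r"
    and "f d j (take (Suc r) (accepted d j)) < cap d"
proof -
  note st = stage_properties[OF ys_enough assms(1), folded assms(2)]
  show d: "d \<le> L" and r: "r < cap d" using st assms(4) by auto
  show j: "j < 2 ^ (L - d)" using K_less[OF d] assms(3) by simp
  note na = nth_arrivals[OF assms(1) st(3), folded assms(3,4)]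
  show "t = area d j ! r" using na(1) by simp
  have "map ((!) ys) (arrivals K cap ((!) ys) d j (Suc t)) = take (Suc r) (accepted d j)"
    unfolding accepted_def na(2)[symmetric] using r by (simp add: take_map min_def)
  then show "cell t = base d + j * cap d + f d j (take (Suc r) (accepted d j))"
    using cascade_cell_take[of t ys f] assms ys_len by simp
  show "f d j (take (Suc r) (accepted d j)) < cap d"
    using f[OF d, of j, unfolded sorts_in_def, rule_format, OF length_accepted[OF d j]] r by blast
qed

lemma cell_bounds:
  assumes "t < n" "d = stage K cap ((!) ys) t"
  shows "base d \<le> cell t" "cell t < base (Suc d)"
proof -
  define j where "j = K d (ys ! t)"
  define l where "l = f d j (take (Suc (rk ((!) ys) d t)) (accepted d j))"
  have c: "cell t = base d + j * cap d + l" "j < 2 ^ (L - d)" "l < cap d"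
    using cell_eq[OF assms j_def refl] by (auto simp: l_def)
  show "base d \<le> cell t" using c by simp
  have "(j + 1) * cap d \<le> 2 ^ (L - d) * cap d" using c(2) by (intro mult_right_mono) auto
  then show "cell t < base (Suc d)" using c by (simp add: base_Suc)
qed

lemma cell_less: "t < n \<Longrightarrow> cell t < n"
  using cell_bounds(2)[OF _ refl, of t] stage_properties(1)[OF ys_enough, of t] base_total
    base_mono[of "Suc (stage K cap ((!) ys) t)" "Suc L"] by simp

text \<open>Different stages occupy disjoint ranges. Within a stage, quotient and remainder by
  \<open>cap d\<close> recover the area and the local cell; injectivity of the local strategy then
  recovers the rank, and thus the item.\<close>

lemma cell_inj: "inj_on cell {..<n}"
proof (rule inj_onI)
  fix t u assume "t \<in> {..<n}" "u \<in> {..<n}" and eq: "cell t = cell u"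
  then have tu: "t < n" "u < n" by auto
  define d where "d = stage K cap ((!) ys) t"
  define d' where "d' = stage K cap ((!) ys) u"
  note bt = cell_bounds[OF tu(1) d_def] and bu = cell_bounds[OF tu(2) d'_def]
  have "\<not> d < d'" using bt bu eq base_mono[of "Suc d" d'] by auto
  moreover have "\<not> d' < d" using bt bu eq base_mono[of "Suc d'" d] by auto
  ultimately have dd: "d' = d" by simp
  define j where "j = K d (ys ! t)"
  define j' where "j' = K d (ys ! u)"
  define r where "r = rk ((!) ys) d t"
  define r' where "r' = rk ((!) ys) d u"
  define l where "l = f d j (take (Suc r) (accepted d j))"
  define l' where "l' = f d j' (take (Suc r') (accepted d j'))"
  note ct = cell_eq[OF tu(1) d_def j_def r_def, folded l_def]
  note cu = cell_eq[OF tu(2) d'_def[unfolded dd] j'_def r'_def, folded l'_def]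
  have "j * cap d + l = j' * cap d + l'" using ct(1) cu(1) eq by simp
  then have "(j * cap d + l) div cap d = (j' * cap d + l') div cap d" "(j * cap d + l) mod cap d = (j' * cap d + l') mod cap d"
    by simp_all
  then have jl: "j = j'" "l = l'" using ct(6) cu(6) by simp_all
  have "inj_on (\<lambda>t. f d j (take (Suc t) (accepted d j))) {..<cap d}"
    using f[OF ct(2), of j, unfolded sorts_in_def, rule_format, OF length_accepted[OF ct(2,3)]] by blast
  then have "r = r'" using inj_onD[of _ "{..<cap d}" r r'] jl ct(4) cu(4) by (simp add: l_def l'_def)
  then show "t = u" using ct(5) cu(5) jl by simp
qed

text \<open>An arrival of rank below \<open>cap d\<close> stays at stage \<open>d\<close>, so the
  area ends up holding precisely the accepted list, and the guarantee of the local strategy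
  applies.\<close>

lemma area_contents:
  assumes d: "d \<le> L" and j: "j < 2 ^ (L - d)" and A: "\<And>t. t < n \<Longrightarrow> A (cell t) = ys ! t"
  defines "B \<equiv> \<lambda>l. A (base d + j * cap d + l)"
  shows "variation (cap d) B \<le> 100 * sqrt (real (cap d)) * (1 / 2 ^ (L - d))"
    and "\<And>l. l < cap d \<Longrightarrow> B l \<in> {real j / 2 ^ (L - d)..real j / 2 ^ (L - d) + 1 / 2 ^ (L - d)}"
proof -
  note len = length_accepted[OF d j]
  have acc: "B (f d j (take (Suc r) (accepted d j))) = accepted d j ! r"
    "accepted d j ! r \<in> {real j / 2 ^ (L - d)..real j / 2 ^ (L - d) + 1 / 2 ^ (L - d)}" if r: "r < cap d" for r
  proof -
    define t where "t = area d j ! r"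
    have rl: "r < length (area d j)" using r area_ge[OF d j] by simp
    note t = arrivals_nth[OF rl, folded t_def]
    have st: "stage K cap ((!) ys) t = d" using t(2,4) r by (intro stage_eqI) auto
    have "cell t = base d + j * cap d + f d j (take (Suc r) (accepted d j))"
      using cell_eq(1)[OF t(1) st[symmetric] t(3)[symmetric] t(4)[symmetric]] .
    moreover have a: "accepted d j ! r = ys ! t" using r rl by (simp add: accepted_def t_def)
    ultimately show "B (f d j (take (Suc r) (accepted d j))) = accepted d j ! r"
      using A[OF t(1)] by (simp add: B_def)
    have "ys ! t \<in> {0..1}" using t(1) ys_len ys_mem nth_mem by blast
    from K_mem[OF d this] show "accepted d j ! r \<in> {real j / 2 ^ (L - d)..real j / 2 ^ (L - d) + 1 / 2 ^ (L - d)}"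
      unfolding a t(3) .
  qed
  note F = f[OF d, of j, unfolded sorts_in_def, rule_format, OF len]
  have sub: "set (accepted d j) \<subseteq> {real j / 2 ^ (L - d)..real j / 2 ^ (L - d) + 1 / 2 ^ (L - d)}"
    using acc(2) len by (auto simp: in_set_conv_nth)
  show "variation (cap d) B \<le> 100 * sqrt (real (cap d)) * (1 / 2 ^ (L - d))"
    using F sub acc(1) by blast
  let ?c = "\<lambda>r. f d j (take (Suc r) (accepted d j))"
  have "?c ` {..<cap d} = {..<cap d}"
    using F by (intro card_subset_eq) (auto simp: card_image)
  then have surj: "\<exists>r<cap d. l = ?c r" if "l < cap d" for l using that by blast
  show "B l \<in> {real j / 2 ^ (L - d)..real j / 2 ^ (L - d) + 1 / 2 ^ (L - d)}" if l: "l < cap d" for l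
  proof -
    obtain r where r: "r < cap d" "l = ?c r" using surj[OF l] by blast
    show ?thesis using acc(2)[OF r(1)] unfolding r(2) acc(1)[OF r(1)] .
  qed
qed

text \<open>The 2^(L-d) areas of a stage have width 2^(-(L-d)), so together they cost as much as one
  area of width 1. The 3 consists of 2 for the seams between areas of a stage and 1 for the passage
  to the next stage.\<close>

lemma cascade_cost:
  assumes A: "\<And>t. t < n \<Longrightarrow> A (cell t) = ys ! t"
  shows "variation n A \<le> (\<Sum>d\<le>L. 100 * sqrt (real (cap d)) + 3)"
proof -
  have "cell ` {..<n} = {..<n}"
    using cell_inj cell_less by (intro card_subset_eq) (auto simp: card_image)
  then have surj: "\<exists>t<n. i = cell t" if "i < n" for i using that by blast
  have A01: "A i \<in> {0..1}" if i: "i < n" for i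
  proof -
    obtain t where t: "t < n" "i = cell t" using surj[OF i] by blast
    then have "ys ! t \<in> set ys" using ys_len by simp
    then show ?thesis using A[OF t(1)] t(2) ys_mem by auto
  qed
  have level: "variation (2 ^ (L - d) * cap d) (\<lambda>i. A (base d + i)) \<le> 100 * sqrt (real (cap d)) + 2"
    if d: "d \<le> L" for d
  proof -
    let ?m = "2 ^ (L - d) :: nat" and ?w = "1 / 2 ^ (L - d) :: real"
    let ?B = "\<lambda>j l. A (base d + (j * cap d + l))"
    have "variation (?m * cap d) (\<lambda>i. A (base d + i)) \<le>
       (\<Sum>j<?m. variation (cap d) (?B j)) + real ?m * (2 * ?w)"
    \<comment> \<open>The last cell of one area and the first cell of the next hold items of
      adjacent intervals, which differ by at most two widths.\<close>
    proof (rule variation_equal_blocks)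
      fix j assume j: "0 < j" "j < ?m" "cap d > 0"
      then obtain i where i: "j = Suc i" by (metis gr0_implies_Suc)
      have h1: "A (base d + j * cap d + 0) \<in> {real j / 2 ^ (L - d)..real j / 2 ^ (L - d) + ?w}"
        using j by (intro area_contents(2)[OF d _ A]) auto
      have h2: "A (base d + i * cap d + (cap d - 1)) \<in> {real i / 2 ^ (L - d)..real i / 2 ^ (L - d) + ?w}"
        using j i by (intro area_contents(2)[OF d _ A]) auto
      have idx: "base d + i * cap d + (cap d - 1) = base d + (j * cap d - 1)" using i j by simp
      have "real j / 2 ^ (L - d) = real i / 2 ^ (L - d) + ?w"
        using i by (simp add: add_divide_distrib)
      with h1 h2[unfolded idx]
      show "\<bar>A (base d + j * cap d) - A (base d + (j * cap d - 1))\<bar> \<le> 2 * ?w"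
        unfolding atLeastAtMost_iff add_0_right by linarith
    qed simp
    also have "\<dots> \<le> (\<Sum>j<?m. 100 * sqrt (real (cap d)) * ?w) + real ?m * (2 * ?w)"
    proof (intro add_right_mono sum_mono)
      fix j assume "j \<in> {..<?m}"
      then show "variation (cap d) (?B j) \<le> 100 * sqrt (real (cap d)) * ?w"
        using area_contents(1)[OF d _ A, of j] by (simp add: add.assoc)
    qed
    also have "\<dots> = 100 * sqrt (real (cap d)) + 2" by simp
    finally show ?thesis .
  qed
  have tot: "(\<Sum>d<Suc L. 2 ^ (L - d) * cap d) = n" using base_total by (simp only: base_def)
  have "variation (\<Sum>d<Suc L. 2 ^ (L - d) * cap d) A \<le>
     (\<Sum>d<Suc L. variation (2 ^ (L - d) * cap d) (\<lambda>i. A ((\<Sum>d'<d. 2 ^ (L - d') * cap d') + i)) + 1)"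
  proof (rule variation_blocks)
    fix i i' assume "i < (\<Sum>d<Suc L. 2 ^ (L - d) * cap d)" "i' < (\<Sum>d<Suc L. 2 ^ (L - d) * cap d)"
    then show "\<bar>A i - A i'\<bar> \<le> 1" unfolding tot using A01[of i] A01[of i'] by (auto simp: abs_le_iff)
  qed simp
  also have "\<dots> \<le> (\<Sum>d<Suc L. 100 * sqrt (real (cap d)) + 3)"
  proof (rule sum_mono)
    fix d assume "d \<in> {..<Suc L}"
    then show "variation (2 ^ (L - d) * cap d) (\<lambda>i. A ((\<Sum>d'<d. 2 ^ (L - d') * cap d') + i)) + 1 \<le> 100 * sqrt (real (cap d)) + 3"
      using level[of d] by (simp add: base_def)
  qed
  finally show ?thesis unfolding tot by (simp add: lessThan_Suc_atMost)
qed

end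

end

section \<open>Dyadic intervals and area sizes\<close>

text \<open>The cap assigns \<open>y = 1\<close> to the last interval.\<close>

definition dyadic_box :: "nat \<Rightarrow> real \<Rightarrow> nat" where
  "dyadic_box i y = min (nat \<lfloor>2 ^ i * y\<rfloor>) (2 ^ i - 1)"

lemma dyadic_box_less: "dyadic_box i y < 2 ^ i"
  unfolding dyadic_box_def by (rule le_less_trans[OF min.cobounded2]) simp

text \<open>Both the floor and the cap are compatible with halving; this gives the intervals their
  tree structure.\<close>

lemma dyadic_box_half: "dyadic_box i y = dyadic_box (Suc i) y div 2"
proof -
  have "\<lfloor>2 ^ i * y\<rfloor> = \<lfloor>2 ^ Suc i * y / real_of_int 2\<rfloor>" by simp
  also have "\<dots> = \<lfloor>2 ^ Suc i * y\<rfloor> div 2" by (rule floor_divide_real_eq_div) simp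
  finally have fl: "nat \<lfloor>2 ^ i * y\<rfloor> = nat \<lfloor>2 ^ Suc i * y\<rfloor> div 2" by (simp add: nat_div_distrib')
  have "(2 ^ i - 1 :: nat) = (2 ^ Suc i - 1) div 2" by simp
  moreover have "min a b div 2 = min (a div 2) (b div 2)" for a b :: nat
    by (auto simp: min_def div_le_mono dest: div_le_mono[where k = 2])
  ultimately show ?thesis unfolding dyadic_box_def fl by simp
qed

lemma dyadic_box_mem:
  assumes "y \<in> {0..1}"
  shows "y \<in> {real (dyadic_box i y) / 2 ^ i..real (dyadic_box i y) / 2 ^ i + 1 / 2 ^ i}"
proof -
  have "0 \<le> 2 ^ i * y" "2 ^ i * y \<le> real (2 ^ i)" using assms by auto
  from clamped_floor_bounds[OF this] show ?thesis by (simp add: dyadic_box_def field_simps)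
qed

text \<open>With mean mu = n / 2^i this is the deviation for which dev^2 / (2 mu) = 2 ln n, the
  exponent in Chernoff's bound.\<close>

definition dev :: "nat \<Rightarrow> nat \<Rightarrow> real" where
  "dev n i = 2 * sqrt (real n / 2 ^ i * ln (real n))"

text \<open>The root needs no slack, since its count is always \<open>n\<close>; this also makes the
  areas exhaust the array.\<close>

definition quota :: "nat \<Rightarrow> nat \<Rightarrow> nat" where
  "quota n i = (if i = 0 then n else nat \<lfloor>real n / 2 ^ i - dev n i\<rfloor>)"

text \<open>The assumptions hold for large \<open>n\<close> with \<open>L\<close> the rounded-down
  binary logarithm of sqrt n. \<open>sqrt_ge\<close> keeps the slack below the mean,
  \<open>sqrt_ln\<close> makes it large enough to absorb rounding, and \<open>L_le\<close> lets the
  main term absorb the O(1) cost per level.\<close>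

locale parameters =
  fixes n L :: nat
  assumes ln_ge: "1 \<le> ln (real n)"
    and sqrt_ge: "4 * ln (real n) \<le> sqrt (real n)"
    and sqrt_ln: "9 \<le> sqrt (real n) * ln (real n)"
    and pow_le: "2 ^ L \<le> sqrt (real n)" and pow_ge: "sqrt (real n) \<le> 2 * 2 ^ L"
    and L_le: "3 * (real L + 1) \<le> sqrt (sqrt (real n * ln (real n)))"
begin

abbreviation "R \<equiv> sqrt (sqrt (real n * ln (real n)))"

lemma n_pos: "n > 0"
  using ln_ge by (cases n) auto

lemma mu_ge: "i \<le> L \<Longrightarrow> sqrt (real n) \<le> real n / 2 ^ i"
proof -
  assume "i \<le> L"
  then have "(2::real) ^ i \<le> 2 ^ L" by (intro power_increasing) auto
  then have "2 ^ i \<le> sqrt (real n)" using pow_le by linarith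
  then have "sqrt (real n) * 2 ^ i \<le> sqrt (real n) * sqrt (real n)" by (intro mult_left_mono) auto
  then show ?thesis by (simp add: field_simps)
qed

lemma dev_ge: assumes "i \<le> L" shows "6 \<le> dev n i"
proof -
  have "9 \<le> real n / 2 ^ i * ln (real n)"
    using sqrt_ln mult_right_mono[OF mu_ge[OF assms], of "ln (real n)"] ln_ge by linarith
  then have "3 \<le> sqrt (real n / 2 ^ i * ln (real n))" by (intro real_le_rsqrt) simp
  then show ?thesis by (simp add: dev_def)
qed

lemma dev_le: assumes "i \<le> L" shows "dev n i \<le> real n / 2 ^ i"
proof -
  let ?m = "real n / 2 ^ i"
  have "?m * ln (real n) \<le> ?m * (?m / 4)"
    using sqrt_ge mu_ge[OF assms] by (intro mult_left_mono) auto
  also have "\<dots> = (?m / 2)\<^sup>2" by (simp add: power2_eq_square)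
  finally have "sqrt (?m * ln (real n)) \<le> ?m / 2" by (intro real_le_lsqrt) auto
  then show ?thesis by (simp add: dev_def)
qed

lemma dev_Suc: "dev n (Suc i) = sqrt (1/2) * dev n i"
proof -
  have "real n / 2 ^ Suc i * ln (real n) = (1/2) * (real n / 2 ^ i * ln (real n))" by simp
  then show ?thesis unfolding dev_def by (simp only: real_sqrt_mult)
qed

lemma sqrt_half: "7/10 \<le> sqrt (1/2)" "sqrt (1/2) \<le> 3/4"
proof -
  show "7/10 \<le> sqrt (1/2)" by (rule real_le_rsqrt) (simp add: power2_eq_square)
  show "sqrt (1/2) \<le> 3/4" by (rule real_le_lsqrt) (simp_all add: power2_eq_square)
qed

lemma quota_bounds:
  assumes "1 \<le> i" "i \<le> L"
  shows "real (quota n i) \<le> real n / 2 ^ i - dev n i" "real n / 2 ^ i - dev n i - 1 < real (quota n i)"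
proof -
  have "0 \<le> real n / 2 ^ i - dev n i" using dev_le[OF assms(2)] by simp
  then show "real (quota n i) \<le> real n / 2 ^ i - dev n i" "real n / 2 ^ i - dev n i - 1 < real (quota n i)"
    using assms(1) by (simp_all add: quota_def)
qed

lemma quota_le: "i \<le> L \<Longrightarrow> real (quota n i) \<le> real n / 2 ^ i"
  using quota_bounds(1)[of i] dev_ge[of i] by (cases "i = 0") (auto simp: quota_def)

text \<open>The slack of a child is that of the parent divided by sqrt 2, so two children fall short
  of the mean by sqrt 2 times the parent's slack. This exceeds the parent's own slack, so the
  parent's area has nonnegative size, and it is still O(dev), so the area is small.\<close>

lemma quota_halving:
  assumes "i < L"
  shows "2 * quota n (Suc i) \<le> quota n i"
    and "real (quota n i - 2 * quota n (Suc i)) \<le> 3 * dev n i"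
proof -
  have d: "6 \<le> dev n i" using dev_ge[of i] assms by simp
  have q: "real (quota n (Suc i)) \<le> real n / 2 ^ Suc i - dev n (Suc i)"
    "real n / 2 ^ Suc i - dev n (Suc i) - 1 < real (quota n (Suc i))"
    using quota_bounds[of "Suc i"] assms by auto
  have h: "2 * (real n / 2 ^ Suc i) = real n / 2 ^ i" by simp
  have s: "7/10 * dev n i \<le> dev n (Suc i)" "dev n (Suc i) \<le> 3/4 * dev n i"
    unfolding dev_Suc using sqrt_half d by (auto intro!: mult_right_mono)
  have "2 * real (quota n (Suc i)) \<le> real n / 2 ^ i - 2 * dev n (Suc i)" using q(1) h by linarith
  also have "\<dots> \<le> real (quota n i)"
  proof (cases "i = 0")
    case True
    then show ?thesis using s d by (simp add: quota_def)
  next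
    case False
    then have "real n / 2 ^ i - dev n i - 1 < real (quota n i)"
      using quota_bounds(2)[of i] assms by simp
    then show ?thesis using s(1) d by linarith
  qed
  finally show le: "2 * quota n (Suc i) \<le> quota n i" by linarith
  have "real (quota n i - 2 * quota n (Suc i)) = real (quota n i) - 2 * real (quota n (Suc i))"
    using le by (simp add: of_nat_diff)
  also have "\<dots> \<le> real n / 2 ^ i - 2 * real (quota n (Suc i))"
    using quota_le[of i] assms by simp
  also have "\<dots> \<le> 3 * dev n i" using q(2) h s(2) d by linarith
  finally show "real (quota n i - 2 * quota n (Suc i)) \<le> 3 * dev n i" .
qed

definition area_size :: "nat \<Rightarrow> nat" where
  "area_size i = (if i = L then quota n L else quota n i - 2 * quota n (Suc i))"

abbreviation "q \<equiv> sqrt (sqrt (1/2)) :: real"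

lemma q_le: "q \<le> 85/100"
  by (intro real_le_lsqrt) (auto simp: power2_eq_square)

lemma q_sum: "(\<Sum>i<L. q ^ i) \<le> 7"
proof -
  have ne: "q \<noteq> 1" by (simp del: real_sqrt_eq_iff)
  have "(\<Sum>i<L. q ^ i) = (1 - q ^ L) / (1 - q)"
    using geometric_sum[OF ne, of L] by (simp add: field_simps)
  also have "\<dots> \<le> 1 / (1 - q)" using q_le by (intro divide_right_mono) auto
  \<comment> \<open>\<open>1 / (1 - 0.85)\<close> is less than 6.7.\<close>
  also have "\<dots> \<le> 7" using q_le by (simp add: divide_le_eq)
  finally show ?thesis .
qed

lemma dev_eq: "dev n i = 2 * sqrt (real n * ln (real n)) * sqrt (1/2) ^ i"
  by (induction i) (simp_all only: dev_Suc, simp_all add: dev_def)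

lemma sqrt_area_inner:
  assumes "i < L"
  shows "sqrt (real (area_size i)) \<le> 3 * R * q ^ i"
proof -
  have "real (area_size i) \<le> 3 * dev n i"
    using quota_halving(2)[OF assms] assms by (simp add: area_size_def)
  \<comment> \<open>The true factor is 6; it is raised to the square 9 so that its root is
    3.\<close>
  also have "\<dots> \<le> 9 * (sqrt (real n * ln (real n)) * sqrt (1/2) ^ i)"
    unfolding dev_eq using ln_ge by simp
  finally have "sqrt (real (area_size i)) \<le> sqrt (9 * (sqrt (real n * ln (real n)) * sqrt (1/2) ^ i))"
    by (rule real_sqrt_le_mono)
  also have "\<dots> = 3 * (R * q ^ i)" by (simp only: real_sqrt_mult real_sqrt_power) simp
  finally show ?thesis by simp
qed

lemma sqrt_area_leaf: "sqrt (real (area_size L)) \<le> 2 * R"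
proof -
  have "real (area_size L) \<le> real n / 2 ^ L" using quota_le[of L] by (simp add: area_size_def)
  also have "\<dots> \<le> 2 * sqrt (real n)"
  proof -
    have "real n = sqrt (real n) * sqrt (real n)" by simp
    also have "\<dots> \<le> sqrt (real n) * (2 * 2 ^ L)" using pow_ge by (intro mult_left_mono) auto
    finally show ?thesis by (simp add: field_simps)
  qed
  also have "\<dots> \<le> 4 * sqrt (real n * ln (real n))"
  proof -
    have "sqrt (real n) \<le> sqrt (real n * ln (real n))"
      using ln_ge by (intro real_sqrt_le_mono) (simp add: mult_le_cancel_left1)
    moreover have "0 \<le> sqrt (real n)" by simp
    ultimately show ?thesis by linarith
  qed
  finally have "sqrt (real (area_size L)) \<le> sqrt (4 * sqrt (real n * ln (real n)))"
    by (rule real_sqrt_le_mono)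
  then show ?thesis by (simp add: real_sqrt_mult)
qed

text \<open>2301 = 300 * 7 + 100 * 2 + 1: the geometric series over inner levels, the leaves, and
  the level transitions.\<close>

lemma total_cost: "(\<Sum>d\<le>L. 100 * sqrt (real (area_size (L - d))) + 3) \<le> 2301 * R"
proof -
  have "(\<Sum>d\<le>L. 100 * sqrt (real (area_size (L - d))) + 3) = (\<Sum>i\<le>L. 100 * sqrt (real (area_size i)) + 3)"
    using sum.nat_diff_reindex[of "\<lambda>i. 100 * sqrt (real (area_size i)) + 3" "Suc L"]
    by (simp only: lessThan_Suc_atMost diff_Suc_Suc)
  also have "\<dots> = (\<Sum>i<L. 100 * sqrt (real (area_size i))) + 100 * sqrt (real (area_size L)) + 3 * (real L + 1)"
    by (simp add: lessThan_Suc_atMost[symmetric] sum.distrib algebra_simps)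
  also have "\<dots> \<le> (\<Sum>i<L. 300 * R * q ^ i) + 100 * (2 * R) + R"
  proof (intro add_mono sum_mono)
    fix i assume "i \<in> {..<L}"
    then show "100 * sqrt (real (area_size i)) \<le> 300 * R * q ^ i" using sqrt_area_inner[of i] by simp
  qed (use sqrt_area_leaf L_le in simp_all)
  also have "(\<Sum>i<L. 300 * R * q ^ i) = 300 * R * (\<Sum>i<L. q ^ i)" by (simp only: sum_distrib_left)
  also have "\<dots> \<le> 300 * R * 7" using q_sum ln_ge by (intro mult_left_mono) auto
  finally show ?thesis by simp
qed

text \<open>Instantiates the cascade with stage \<open>d\<close> as level \<open>L - d\<close>.
  Counts are assumed from level 1 on, as the single interval of level 0 contains all
  \<open>n\<close> items.\<close>

theorem strategy_exists:
  "\<exists>F. \<forall>ys. length ys = n \<and> set ys \<subseteq> {0..1} \<and>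
      (\<forall>i\<in>{1..L}. \<forall>j<2 ^ i. quota n i \<le> card {t. t < n \<and> dyadic_box i (ys ! t) = j}) \<longrightarrow>
    inj_on (\<lambda>t. F (take (Suc t) ys)) {..<n} \<and> (\<forall>t<n. F (take (Suc t) ys) < n) \<and>
    (\<forall>A. (\<forall>t<n. A (F (take (Suc t) ys)) = ys ! t) \<longrightarrow> variation n A \<le> 2301 * R)"
proof -
  interpret C: dyadic_cascade "\<lambda>d. dyadic_box (L - d)" "\<lambda>d. area_size (L - d)" "\<lambda>d. quota n (L - d)" L n
  proof
    show "dyadic_box (L - d) y < 2 ^ (L - d)" for d y by (rule dyadic_box_less)
    show "dyadic_box (L - Suc d) y = dyadic_box (L - d) y div 2" if "d < L" for d y
      using dyadic_box_half[of "L - Suc d" y] that by (simp add: Suc_diff_Suc)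
    show "quota n (L - 0) = area_size (L - 0)" by (simp add: area_size_def)
    show "quota n (L - Suc d) = 2 * quota n (L - d) + area_size (L - Suc d)" if "d < L" for d
      using that quota_halving(1)[of "L - Suc d"] by (auto simp: area_size_def Suc_diff_Suc)
    show "quota n (L - L) = n" by (simp add: quota_def)
  qed
  have "\<exists>f. \<forall>d j. sorts_in (area_size (L - d)) (real j / 2 ^ (L - d)) (1 / 2 ^ (L - d))
      (100 * sqrt (real (area_size (L - d))) * (1 / 2 ^ (L - d))) (f d j)"
    by (intro choice allI sqrt_strategy) simp
  then obtain f :: "nat \<Rightarrow> nat \<Rightarrow> real list \<Rightarrow> nat" where f:
    "\<And>d j. sorts_in (area_size (L - d)) (real j / 2 ^ (L - d)) (1 / 2 ^ (L - d))
      (100 * sqrt (real (area_size (L - d))) * (1 / 2 ^ (L - d))) (f d j)" by blast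
  show ?thesis
  proof (intro exI[of _ "C.cascade_cell f"] allI impI)
    fix ys :: "real list"
    assume "length ys = n \<and> set ys \<subseteq> {0..1} \<and>
      (\<forall>i\<in>{1..L}. \<forall>j<2 ^ i. quota n i \<le> card {t. t < n \<and> dyadic_box i (ys ! t) = j})"
    then have ys: "length ys = n" "set ys \<subseteq> {0..1}"
      and cnt: "\<And>i j. i \<in> {1..L} \<Longrightarrow> j < 2 ^ i \<Longrightarrow> quota n i \<le> card {t. t < n \<and> dyadic_box i (ys ! t) = j}" by auto
    have enough: "C.enough ((!) ys)"
      unfolding C.enough_def
    proof (intro allI impI)
      fix d j :: nat assume d: "d \<le> L" "j < 2 ^ (L - d)"
      show "quota n (L - d) \<le> card {t. t < n \<and> dyadic_box (L - d) (ys ! t) = j}"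
      proof (cases "d = L")
        case True
        then have "{t. t < n \<and> dyadic_box (L - d) (ys ! t) = j} = {..<n}" using d dyadic_box_less[of 0] by auto
        then show ?thesis using True by (simp add: quota_def)
      next
        case False
        then show ?thesis using d by (intro cnt) auto
      qed
    qed
    have f': "sorts_in (area_size (L - d)) (real j / 2 ^ (L - d)) (1 / 2 ^ (L - d))
      (100 * sqrt (real (area_size (L - d))) * (1 / 2 ^ (L - d))) (f d j)" if "d \<le> L" for d j by (rule f)
    have mem: "y \<in> {real (dyadic_box (L - d) y) / 2 ^ (L - d)..real (dyadic_box (L - d) y) / 2 ^ (L - d) + 1 / 2 ^ (L - d)}"
      if "d \<le> L" "y \<in> {0..1}" for d y using that(2) by (rule dyadic_box_mem)
    note ctx = f' mem ys enough
    have 1: "inj_on (\<lambda>t. C.cascade_cell f (take (Suc t) ys)) {..<n}"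
      by (rule C.cell_inj[OF ctx])
    have 2: "\<forall>t<n. C.cascade_cell f (take (Suc t) ys) < n"
      using C.cell_less[OF ctx] by blast
    have 3: "variation n A \<le> 2301 * R" if "\<forall>t<n. A (C.cascade_cell f (take (Suc t) ys)) = ys ! t" for A
      using C.cascade_cost[OF ctx, of A] that total_cost by force
    from 1 2 3 show "inj_on (\<lambda>t. C.cascade_cell f (take (Suc t) ys)) {..<n} \<and>
      (\<forall>t<n. C.cascade_cell f (take (Suc t) ys) < n) \<and>
      (\<forall>A. (\<forall>t<n. A (C.cascade_cell f (take (Suc t) ys)) = ys ! t) \<longrightarrow> variation n A \<le> 2301 * R)"
      by blast
  qed
qed

end

section \<open>Probability and measurability\<close>

abbreviation unit_uniform :: "real measure" where
  "unit_uniform \<equiv> uniform_measure lborel {0<..1}"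

lemma prob_space_unit_uniform: "prob_space unit_uniform"
  by (rule prob_space_uniform_measure) auto

lemma finite_product_prob_space_uniform: "finite_product_prob_space (\<lambda>_. unit_uniform) {1..n::nat}"
proof -
  interpret U: prob_space unit_uniform by (rule prob_space_unit_uniform)
  show ?thesis by unfold_locales auto
qed

lemma prob_space_uniform_input: "prob_space (uniform_input n)"
  unfolding uniform_input_def by (rule prob_space_PiM) (rule prob_space_unit_uniform)

lemma component_measurable [measurable]:
  "t \<in> {1..n} \<Longrightarrow> (\<lambda>x. x t) \<in> borel_measurable (uniform_input n)"
  unfolding uniform_input_def by measurable

section \<open>Chernoff's bound for the number of items in an interval\<close>

lemma exp_minus_le_quadratic:
  fixes l :: real
  assumes "l \<ge> 0"
  shows "exp (- l) \<le> 1 - l + l\<^sup>2 / 2"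
proof -
  have pos: "1 - l + l\<^sup>2 / 2 > 0"
  proof -
    have "1 - l + l\<^sup>2 / 2 = ((1 - l)\<^sup>2 + 1) / 2" by (simp add: power2_eq_square field_simps)
    also have "\<dots> > 0" by (simp add: add_nonneg_pos)
    finally show ?thesis .
  qed
  \<comment> \<open>The product is 1 + l^4 / 4, and its second factor is a lower bound for exp
    l.\<close>
  have "1 \<le> (1 - l + l\<^sup>2 / 2) * (1 + l + l\<^sup>2 / 2)"
  proof -
    have "(1 - l + l\<^sup>2 / 2) * (1 + l + l\<^sup>2 / 2) = 1 + (l\<^sup>2)\<^sup>2 / 4"
      by (simp add: power2_eq_square field_simps)
    then show ?thesis by simp
  qed
  also have "\<dots> \<le> (1 - l + l\<^sup>2 / 2) * exp l"
    using pos exp_lower_Taylor_quadratic[OF assms] by (intro mult_left_mono) auto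
  finally show ?thesis by (simp add: exp_minus field_simps)
qed

text \<open>Markov's inequality is applied to exp(-l N). By independence its expectation is the
  \<open>n\<close>-th power of a single factor, which 1 + x \<le> exp x and the quadratic bound turn
  into the Gaussian exponent.\<close>

lemma uniform_lower_tail:
  fixes a b s :: real and n :: nat
  assumes ab: "0 \<le> a" "a < b" "b \<le> 1" and n: "n \<ge> 1" and s: "s \<ge> 0"
    and k: "real k \<le> real n * (b - a) - s"
  defines "m \<equiv> real n * (b - a)"
  defines "N \<equiv> \<lambda>x::nat \<Rightarrow> real. card {t\<in>{1..n}. x t \<in> {a<..<b}}"
  shows "measure (uniform_input n) {x \<in> space (uniform_input n). N x < k} \<le> exp (- (s\<^sup>2 / (2 * m)))"
    and "{x \<in> space (uniform_input n). N x < k} \<in> sets (uniform_input n)"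
proof -
  interpret finite_product_prob_space "\<lambda>_. unit_uniform" "{1..n}"
    by (rule finite_product_prob_space_uniform)
  let ?M = "uniform_input n"
  interpret Q: prob_space ?M by (rule prob_space_uniform_input)
  have m: "m > 0" using ab n by (simp add: m_def)
  \<comment> \<open>Minimises the final exponent m l^2 / 2 - s l.\<close>
  define l where "l = s / m"
  have l: "l \<ge> 0" using m s by (simp add: l_def)
  define I where "I = {a<..<b}"
  have N_sum: "real (N x) = (\<Sum>t\<in>{1..n}. indicator I (x t))" for x
  proof -
    have "(\<Sum>t\<in>{1..n}. indicator I (x t)) = (\<Sum>t\<in>{1..n}. if x t \<in> {a<..<b} then 1 else (0::real))"
      by (intro sum.cong) (auto simp: I_def indicator_def)
    also have "\<dots> = real (N x)" by (simp add: N_def sum.If_cases Int_def)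
    finally show ?thesis by simp
  qed
  have I_sets: "I \<in> sets borel" by (simp add: I_def)
  have N_meas: "(\<lambda>x. real (N x)) \<in> borel_measurable ?M"
    unfolding N_sum using I_sets by measurable
  have "{x \<in> space ?M. real (N x) < real k} \<in> sets ?M" using N_meas by measurable
  then show "{x \<in> space ?M. N x < k} \<in> sets ?M" by simp
  define g where "g = (\<lambda>y. 1 - (1 - exp (- l)) * indicator I y :: real)"
  have exp_N: "exp (- l * real (N x)) = (\<Prod>t\<in>{1..n}. g (x t))" for x
  proof -
    have "exp (- l * real (N x)) = (\<Prod>t\<in>{1..n}. exp (- l * indicator I (x t)))"
      unfolding N_sum by (simp add: sum_distrib_left exp_sum)
    also have "\<dots> = (\<Prod>t\<in>{1..n}. g (x t))"
      by (intro prod.cong) (auto simp: g_def indicator_def)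
    finally show ?thesis .
  qed
  have ind: "integrable unit_uniform (indicator I :: real \<Rightarrow> real)"
    using I_sets by (intro integrable_real_indicator) (auto simp: less_top[symmetric] finite_measure.emeasure_finite[OF prob_space.finite_measure[OF prob_space_unit_uniform]] simp del: emeasure_uniform_measure)
  have int_ind: "integral\<^sup>L unit_uniform (indicator I :: real \<Rightarrow> real) = b - a"
  proof -
    have "{0<..1} \<inter> I = I" using ab by (auto simp: I_def)
    then have "measure unit_uniform I = b - a"
      using ab I_sets by (subst measure_uniform_measure) (auto simp: I_def)
    then show ?thesis by simp
  qed
  have g_int: "integrable unit_uniform g"
    unfolding g_def using ind by simp
  have g_val: "integral\<^sup>L unit_uniform g = 1 - (1 - exp (- l)) * (b - a)"
    unfolding g_def using ind int_ind by (simp add: prob_space.prob_space[OF prob_space_unit_uniform, simplified])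
  have f_int: "integrable ?M (\<lambda>x. \<Prod>t\<in>{1..n}. g (x t))"
    unfolding uniform_input_def using g_int by (intro product_integrable_prod) auto
  have f_val: "(\<integral>x. (\<Prod>t\<in>{1..n}. g (x t)) \<partial>?M) = (1 - (1 - exp (- l)) * (b - a)) ^ n"
    unfolding uniform_input_def using g_int by (subst product_integral_prod) (auto simp: g_val)
  have "measure ?M {x \<in> space ?M. N x < k}
      \<le> measure ?M {x \<in> space ?M. exp (- l * (m - s)) \<le> (\<Prod>t\<in>{1..n}. g (x t))}"
  proof (rule Q.finite_measure_mono)
    have "exp (- l * (m - s)) \<le> exp (- l * real (N x))" if "N x < k" for x
      using l that k by (auto simp: m_def intro: mult_left_mono)
    then show "{x \<in> space ?M. N x < k} \<subseteq> {x \<in> space ?M. exp (- l * (m - s)) \<le> (\<Prod>t\<in>{1..n}. g (x t))}"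
      unfolding exp_N[symmetric] by blast
    have "(\<lambda>x. \<Prod>t\<in>{1..n}. g (x t)) \<in> borel_measurable ?M" using f_int by simp
    then show "{x \<in> space ?M. exp (- l * (m - s)) \<le> (\<Prod>t\<in>{1..n}. g (x t))} \<in> sets ?M" by measurable
  qed
  also have "\<dots> \<le> (\<integral>x. (\<Prod>t\<in>{1..n}. g (x t)) \<partial>?M) / exp (- l * (m - s))"
  proof (rule integral_Markov_inequality_measure[OF f_int sets.top])
    show "AE x in ?M. 0 \<le> (\<Prod>t\<in>{1..n}. g (x t))" unfolding exp_N[symmetric] by simp
  qed simp
  also have "\<dots> = (1 - (1 - exp (- l)) * (b - a)) ^ n * exp (l * (m - s))"
    by (simp only: f_val mult_minus_left exp_minus divide_inverse inverse_inverse_eq)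
  also have "\<dots> \<le> exp (- ((1 - exp (- l)) * (b - a))) ^ n * exp (l * (m - s))"
  proof (intro mult_right_mono power_mono)
    show "1 - (1 - exp (- l)) * (b - a) \<le> exp (- ((1 - exp (- l)) * (b - a)))"
      using exp_ge_add_one_self[of "- ((1 - exp (- l)) * (b - a))"] by simp
    have "(1 - exp (- l)) * (b - a) \<le> 1 * 1" using ab l by (intro mult_mono) auto
    then show "0 \<le> 1 - (1 - exp (- l)) * (b - a)" by simp
  qed simp
  also have "\<dots> = exp (- (m * (1 - exp (- l))) + l * (m - s))"
    unfolding exp_of_nat_mult[symmetric] exp_add[symmetric] by (simp add: m_def algebra_simps)
  also have "\<dots> \<le> exp (- (m * (l - l\<^sup>2 / 2)) + l * (m - s))"
    using exp_minus_le_quadratic[OF l] m by (intro iffD2[OF exp_le_cancel_iff] add_right_mono le_imp_neg_le mult_left_mono) auto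
  also have "- (m * (l - l\<^sup>2 / 2)) + l * (m - s) = - (s\<^sup>2 / (2 * m))"
    using m by (simp add: l_def power2_eq_square field_simps)
  finally show "measure ?M {x \<in> space ?M. N x < k} \<le> exp (- (s\<^sup>2 / (2 * m)))" .
qed

text \<open>The single-item measure lives on the whole real line, so membership of the items in the
  unit interval is only an almost sure event and has to be intersected explicitly.\<close>

lemma uniform_input_support:
  "measure (uniform_input n) (PiE {1..n} (\<lambda>_. {0<..1})) = 1"
  "PiE {1..n} (\<lambda>_. {0<..1}) \<in> sets (uniform_input n)"
proof -
  interpret finite_product_prob_space "\<lambda>_. unit_uniform" "{1..n}"
    by (rule finite_product_prob_space_uniform)
  show "measure (uniform_input n) (PiE {1..n} (\<lambda>_. {0<..1})) = 1"
    unfolding uniform_input_def by (subst finite_measure_PiM_emb) auto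
  show "PiE {1..n} (\<lambda>_. {0<..1}) \<in> sets (uniform_input n)"
    unfolding uniform_input_def by (intro sets_PiM_I_finite) auto
qed

section \<open>Measurability of the success event\<close>

lemma inv_into_cong_on:
  assumes "\<And>j. j \<in> A \<Longrightarrow> p j = q j"
  shows "inv_into A p = inv_into A q"
proof
  fix i
  have "(\<lambda>y. y \<in> A \<and> p y = i) = (\<lambda>y. y \<in> A \<and> q y = i)" using assms by auto
  then show "inv_into A p i = inv_into A q i" by (simp add: inv_into_def)
qed

lemma array_cost_measurable:
  assumes "\<And>i. i \<in> {1..n} \<Longrightarrow> \<pi> i \<in> {1..n}"
  shows "(\<lambda>x. array_cost n (\<lambda>i. x (\<pi> i))) \<in> borel_measurable (uniform_input n)"
  unfolding array_cost_def
proof (intro borel_measurable_sum)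
  fix i assume "i \<in> {1..n - 1}"
  then have "i + 1 \<in> {1..n}" "i \<in> {1..n}" by auto
  then have "\<pi> (i + 1) \<in> {1..n}" "\<pi> i \<in> {1..n}" using assms[of "i + 1"] assms[of i] by auto
  then show "(\<lambda>x. \<bar>x (\<pi> (i + 1)) - x (\<pi> i)\<bar>) \<in> borel_measurable (uniform_input n)" by measurable
qed

lemma offline_opt_measurable: "offline_opt n \<in> borel_measurable (uniform_input n)"
proof -
  have "(\<lambda>x. Min ((\<lambda>p. array_cost n (filled_array n x p)) ` {p. p permutes {1..n}}))
     \<in> borel_measurable (uniform_input n)"
  proof (rule borel_measurable_Min)
    show "finite {p. p permutes {1..n}}" by (rule finite_permutations) simp
    fix p assume "p \<in> {p. p permutes {1..n}}"
    then have "inv_into {1..n} p i \<in> {1..n}" if "i \<in> {1..n}" for i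
      using that permutes_image[of p "{1..n}"] by (intro inv_into_into) auto
    then show "(\<lambda>x. array_cost n (filled_array n x p)) \<in> borel_measurable (uniform_input n)"
      unfolding filled_array_def by (rule array_cost_measurable)
  qed
  then show ?thesis unfolding offline_opt_def[abs_def] .
qed

lemma online_cell_bij:
  assumes "online_sorting_algorithm n alg"
  shows "bij_betw (online_cell alg x) {1..n} {1..n}"
proof -
  have inj: "inj_on (online_cell alg x) {1..n}"
  proof (rule linorder_inj_onI)
    fix i j :: nat assume "i < j" "i \<in> {1..n}" "j \<in> {1..n}"
    then have "online_cell alg x j \<noteq> online_cell alg x i"
      using assms unfolding online_sorting_algorithm_def by auto
    then show "online_cell alg x i \<noteq> online_cell alg x j" by simp
  qed auto
  with assms have "inj_on (online_cell alg x) {1..n}" "online_cell alg x ` {1..n} \<subseteq> {1..n}"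
    unfolding online_sorting_algorithm_def by auto
  then have "online_cell alg x ` {1..n} = {1..n}"
    by (intro card_subset_eq) (auto simp: card_image)
  with inj show ?thesis by (simp add: bij_betw_def)
qed

text \<open>The list of keys takes countably many values. Where it is constant, the algorithm
  applies one fixed placement, so its cost is a finite sum of measurable functions there, and the
  event is a countable union of such pieces.\<close>

lemma success_event_measurable:
  fixes key :: "real \<Rightarrow> int" and alg' :: "int list \<Rightarrow> nat" and \<rho> :: real
  assumes key: "key \<in> borel \<rightarrow>\<^sub>M count_space UNIV"
    and alg: "online_sorting_algorithm n (\<lambda>h. alg' (map key h))"
  shows "{x \<in> space (uniform_input n). online_cost n (\<lambda>h. alg' (map key h)) x \<le> \<rho> * offline_opt n x}
     \<in> sets (uniform_input n)"
proof -
  let ?M = "uniform_input n" and ?alg = "\<lambda>h. alg' (map key h)"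
  define T where "T = (\<lambda>x::nat \<Rightarrow> real. map (\<lambda>j. key (x j)) [1..<Suc n])"
  define p where "p = (\<lambda>l j. alg' (take j l))"
  define c where "c = (\<lambda>l x. array_cost n (\<lambda>i. x (inv_into {1..n} (p l) i)))"
  have cell: "online_cell ?alg x j = p (T x) j" if "j \<in> {1..n}" for x j
  proof -
    have "take j (T x) = map (\<lambda>j. key (x j)) [1..<Suc j]"
      using that by (auto simp: T_def take_map take_upt simp del: upt_Suc)
    then show ?thesis by (simp add: online_cell_def p_def o_def del: upt_Suc)
  qed
  have inv_eq: "inv_into {1..n} (online_cell ?alg x) = inv_into {1..n} (p (T x))" for x
    by (rule inv_into_cong_on) (rule cell)
  have cost: "online_cost n ?alg x = c (T x) x" for x
    unfolding online_cost_def c_def filled_array_def[abs_def] inv_eq ..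
  have T_meas: "{x \<in> space ?M. T x = l} \<in> sets ?M" for l
  proof (cases "length l = n")
    case False
    then have "{x \<in> space ?M. T x = l} = {}" by (auto simp: T_def simp del: upt_Suc)
    then show ?thesis by (simp only: sets.empty_sets)
  next
    case True
    have "{x \<in> space ?M. T x = l} = {x \<in> space ?M. \<forall>j\<in>{1..n}. key (x j) = l ! (j - 1)}"
    proof -
      have "T x = l \<longleftrightarrow> (\<forall>j\<in>{1..n}. key (x j) = l ! (j - 1))" for x
      proof
        assume Tl: "T x = l"
        show "\<forall>j\<in>{1..n}. key (x j) = l ! (j - 1)"
          unfolding Tl[symmetric] by (auto simp: T_def simp del: upt_Suc)
      next
        assume "\<forall>j\<in>{1..n}. key (x j) = l ! (j - 1)"
        then show "T x = l" using True by (intro nth_equalityI) (auto simp: T_def simp del: upt_Suc)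
      qed
      then show ?thesis by simp
    qed
    moreover have "{x \<in> space ?M. \<forall>j\<in>{1..n}. key (x j) = l ! (j - 1)} \<in> sets ?M"
    proof (rule sets.sets_Collect_finite_All)
      fix j assume "j \<in> {1..n}"
      then have "(\<lambda>x. key (x j)) \<in> ?M \<rightarrow>\<^sub>M count_space UNIV"
        using measurable_compose[OF component_measurable key] by simp
      then show "{x \<in> space ?M. key (x j) = l ! (j - 1)} \<in> sets ?M" by measurable
    qed simp
    ultimately show ?thesis by simp
  qed
  have "{x \<in> space ?M. T x = l \<and> c l x \<le> \<rho> * offline_opt n x} \<in> sets ?M" for l
  \<comment> \<open>Validity of the algorithm makes \<open>p l\<close> a bijection only for key
    lists that occur; for the other lists the piece is empty.\<close>
  proof (cases "\<exists>x. T x = l")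
    case True
    then obtain x where "T x = l" by auto
    with cell[of _ x] have "bij_betw (online_cell ?alg x) {1..n} {1..n} = bij_betw (p l) {1..n} {1..n}"
      by (intro bij_betw_cong) simp
    with online_cell_bij[OF alg, of x] have "bij_betw (p l) {1..n} {1..n}" by simp
    then have "inv_into {1..n} (p l) i \<in> {1..n}" if "i \<in> {1..n}" for i
      using that by (intro inv_into_into) (auto simp: bij_betw_def)
    then have "c l \<in> borel_measurable ?M" unfolding c_def by (rule array_cost_measurable)
    then have "{x \<in> space ?M. c l x \<le> \<rho> * offline_opt n x} \<in> sets ?M"
      using offline_opt_measurable[of n] by measurable
    with T_meas[of l] show ?thesis by (intro sets.sets_Collect_conj)
  next
    case False
    then have "{x \<in> space ?M. T x = l \<and> c l x \<le> \<rho> * offline_opt n x} = {}" by auto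
    then show ?thesis by (simp only: sets.empty_sets)
  qed
  then have "(\<Union>l. {x \<in> space ?M. T x = l \<and> c l x \<le> \<rho> * offline_opt n x}) \<in> sets ?M"
    by (intro sets.countable_UN'') auto
  moreover have "{x \<in> space ?M. online_cost n ?alg x \<le> \<rho> * offline_opt n x}
     = (\<Union>l. {x \<in> space ?M. T x = l \<and> c l x \<le> \<rho> * offline_opt n x})"
    unfolding cost by auto
  ultimately show ?thesis by simp
qed

section \<open>The online algorithm\<close>

text \<open>The cells used so far, latest first, for a reversed history: follow \<open>H\<close> as long as it names a
  free cell and use an arbitrary free cell otherwise.\<close>

primrec used_cells :: "nat \<Rightarrow> (real list \<Rightarrow> nat) \<Rightarrow> real list \<Rightarrow> nat list" where
  "used_cells n H [] = []"
| "used_cells n H (y # ys) = (let c = used_cells n H ys; p = H (rev ys @ [y]) in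
     (if p \<in> {1..n} - set c then p else (SOME q. q \<in> {1..n} - set c)) # c)"

definition fallback_alg :: "nat \<Rightarrow> (real list \<Rightarrow> nat) \<Rightarrow> real list \<Rightarrow> nat" where
  "fallback_alg n H h = hd (used_cells n H (rev h))"

lemma used_cells_properties:
  assumes "length ys \<le> n"
  shows "distinct (used_cells n H ys) \<and> set (used_cells n H ys) \<subseteq> {1..n} \<and> length (used_cells n H ys) = length ys"
  using assms
proof (induction ys)
  case (Cons y ys)
  let ?c = "used_cells n H ys"
  have IH: "distinct ?c" "set ?c \<subseteq> {1..n}" "length ?c = length ys" using Cons by auto
  have "card (set ?c) < card {1..n}" using IH Cons.prems by (simp add: distinct_card)
  then have "\<exists>q. q \<in> {1..n} - set ?c"
    by (metis DiffI IH(2) card_mono finite_set leD subsetI)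
  then have "(SOME q. q \<in> {1..n} - set ?c) \<in> {1..n} - set ?c" by (rule someI_ex)
  then show ?case using IH by (auto simp: Let_def)
qed simp

lemma used_cells_online_cell:
  assumes "j \<ge> 1"
  shows "used_cells n H (rev (map x [1..<Suc j])) = online_cell (fallback_alg n H) x j # used_cells n H (rev (map x [1..<j]))"
proof -
  have "rev (map x [1..<Suc j]) = x j # rev (map x [1..<j])" using assms by simp
  then show ?thesis
    by (simp add: online_cell_def fallback_alg_def Let_def del: upt_Suc)
qed

lemma set_used_cells: "set (used_cells n H (rev (map x [1..<Suc j]))) = online_cell (fallback_alg n H) x ` {1..j}"
proof (induction j)
  case (Suc j)
  have "{1..Suc j} = insert (Suc j) {1..j}" by auto
  then show ?case using Suc used_cells_online_cell[of "Suc j" n H x] by (simp del: upt_Suc)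
qed simp

lemma fallback_alg_valid: "online_sorting_algorithm n (fallback_alg n H)"
  unfolding online_sorting_algorithm_def
proof (intro allI ballI conjI)
  fix x and j :: nat assume j: "j \<in> {1..n}"
  let ?f = "used_cells n H (rev (map x [1..<Suc j]))"
  have props: "distinct ?f" "set ?f \<subseteq> {1..n}"
    using used_cells_properties[of "rev (map x [1..<Suc j])" n H] j by auto
  have f: "?f = online_cell (fallback_alg n H) x j # used_cells n H (rev (map x [1..<j]))"
    using j by (intro used_cells_online_cell) auto
  show "online_cell (fallback_alg n H) x j \<in> {1..n}" using props(2) unfolding f by simp
  fix i assume i: "i \<in> {1..<j}"
  obtain j' where j': "j = Suc j'" using j by (cases j) auto
  have "online_cell (fallback_alg n H) x i \<in> set (used_cells n H (rev (map x [1..<j])))"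
    unfolding j' set_used_cells using i j' by auto
  then show "online_cell (fallback_alg n H) x j \<noteq> online_cell (fallback_alg n H) x i"
    using props(1) unfolding f by auto
qed

text \<open>As long as \<open>H\<close> has been followed, the used cells are its own earlier
  answers, so its next answer is free and is followed again.\<close>

lemma fallback_alg_eq:
  assumes range: "\<And>j. j \<in> {1..n} \<Longrightarrow> H (map x [1..<Suc j]) \<in> {1..n}"
    and inj: "inj_on (\<lambda>j. H (map x [1..<Suc j])) {1..n}"
    and "j \<in> {1..n}"
  shows "online_cell (fallback_alg n H) x j = H (map x [1..<Suc j])"
  using assms(3)
proof (induction j rule: less_induct)
  case (less j)
  obtain j' where j': "j = Suc j'" using less.prems by (cases j) auto
  let ?c = "used_cells n H (rev (map x [1..<j]))"
  have "set ?c = online_cell (fallback_alg n H) x ` {1..j'}" unfolding j' by (rule set_used_cells)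
  also have "\<dots> = (\<lambda>j. H (map x [1..<Suc j])) ` {1..j'}"
  proof (rule image_cong[OF refl])
    fix i assume "i \<in> {1..j'}"
    then show "online_cell (fallback_alg n H) x i = H (map x [1..<Suc i])"
      using less.prems j' by (intro less.IH) auto
  qed
  finally have c: "set ?c = (\<lambda>j. H (map x [1..<Suc j])) ` {1..j'}" .
  have "H (map x [1..<Suc j]) \<notin> set ?c"
  proof
    assume "H (map x [1..<Suc j]) \<in> set ?c"
    then obtain i where i: "i \<in> {1..j'}" "H (map x [1..<Suc j]) = H (map x [1..<Suc i])"
      unfolding c by blast
    have "i \<in> {1..n}" using i(1) less.prems j' by auto
    with inj i(2) less.prems have "j = i" by (rule inj_onD)
    then show False using i(1) j' by simp
  qed
  then have free: "H (map x [1..<Suc j]) \<in> {1..n} - set ?c" using range[OF less.prems] by simp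
  have "rev (map x [1..<Suc j]) = x j # rev (map x [1..<j])" using less.prems by simp
  moreover have "rev (rev (map x [1..<j])) @ [x j] = map x [1..<Suc j]" using less.prems by simp
  ultimately have "used_cells n H (rev (map x [1..<Suc j])) = H (map x [1..<Suc j]) # ?c"
    using free by (simp only: used_cells.simps Let_def if_True)
  then show ?case by (simp add: online_cell_def fallback_alg_def del: upt_Suc)
qed

section \<open>Lower bounds on the offline optimum\<close>

lemma array_cost_ge:
  assumes "i \<in> {1..n}" "k \<in> {1..n}"
  shows "\<bar>A k - A i\<bar> \<le> array_cost n A"
proof -
  have *: "\<bar>A k - A i\<bar> \<le> array_cost n A" if ik: "1 \<le> i" "i \<le> k" "k \<le> n" for i k
  proof -
    have "\<bar>A k - A i\<bar> = \<bar>\<Sum>l = i..<k. A (Suc l) - A l\<bar>"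
      using ik by (subst sum_Suc_diff') auto
    also have "\<dots> \<le> (\<Sum>l = i..<k. \<bar>A (Suc l) - A l\<bar>)" by (rule sum_abs)
    also have "\<dots> \<le> (\<Sum>l = 1..n - 1. \<bar>A (Suc l) - A l\<bar>)"
      using ik by (intro sum_mono2) auto
    finally show ?thesis by (simp add: array_cost_def)
  qed
  show ?thesis
  proof (cases "i \<le> k")
    case True
    then show ?thesis using assms by (intro *) auto
  next
    case False
    then have "\<bar>A i - A k\<bar> \<le> array_cost n A" using assms by (intro *) auto
    then show ?thesis by (simp add: abs_minus_commute)
  qed
qed

lemma offline_opt_ge:
  assumes "a \<in> {1..n}" "b \<in> {1..n}"
  shows "\<bar>x b - x a\<bar> \<le> offline_opt n x"
  unfolding offline_opt_def
proof (rule Min.boundedI)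
  show "finite ((\<lambda>p. array_cost n (filled_array n x p)) ` {p. p permutes {1..n}})"
    by (intro finite_imageI finite_permutations) simp
  show "(\<lambda>p. array_cost n (filled_array n x p)) ` {p. p permutes {1..n}} \<noteq> {}"
    using permutes_id by blast
  fix c assume "c \<in> (\<lambda>p. array_cost n (filled_array n x p)) ` {p. p permutes {1..n}}"
  then obtain p where p: "p permutes {1..n}" and c: "c = array_cost n (filled_array n x p)" by auto
  have "filled_array n x p (p i) = x i" if "i \<in> {1..n}" for i
    using that permutes_inj_on[OF p, of "{1..n}"] by (simp add: filled_array_def inv_into_f_f)
  moreover have "p a \<in> {1..n}" "p b \<in> {1..n}" using assms permutes_in_image[OF p] by auto
  ultimately show "\<bar>x b - x a\<bar> \<le> c"
    using array_cost_ge[of "p a" n "p b" "filled_array n x p"] assms c by simp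
qed

text \<open>Each of the \<open>n - 1\<close> jumps is a difference of two items, hence at most the
  optimum. This trivial ratio settles the finitely many small \<open>n\<close>.\<close>

lemma online_cost_le_opt:
  assumes alg: "online_sorting_algorithm n alg" and n: "n \<ge> 1"
  shows "online_cost n alg x \<le> real n * offline_opt n x"
proof -
  let ?A = "filled_array n x (online_cell alg x)"
  have nonneg: "0 \<le> offline_opt n x" using offline_opt_ge[of 1 n 1 x] n by simp
  have inv: "inv_into {1..n} (online_cell alg x) i \<in> {1..n}" if "i \<in> {1..n}" for i
    using that online_cell_bij[OF alg, of x] by (intro inv_into_into) (auto simp: bij_betw_def)
  have "online_cost n alg x \<le> of_nat (card {1..n - 1}) * offline_opt n x"
    unfolding online_cost_def array_cost_def
  proof (rule sum_bounded_above)
    fix i assume "i \<in> {1..n - 1}"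
    then have "i \<in> {1..n}" "i + 1 \<in> {1..n}" by auto
    then show "\<bar>?A (i + 1) - ?A i\<bar> \<le> offline_opt n x"
      unfolding filled_array_def by (intro offline_opt_ge inv)
  qed
  also have "\<dots> \<le> real n * offline_opt n x" using nonneg by (intro mult_right_mono) auto
  finally show ?thesis .
qed

text \<open>The algorithm only sees rounded items, so that it has countably many histories and the event
  of success is measurable.\<close>

definition round_down :: "nat \<Rightarrow> real \<Rightarrow> real" where
  "round_down m y = of_int \<lfloor>2 ^ m * y\<rfloor> / 2 ^ m"

lemma round_down_bounds: "round_down m y \<le> y" "y < round_down m y + 1 / 2 ^ m"
proof -
  have "of_int \<lfloor>2 ^ m * y\<rfloor> \<le> 2 ^ m * y" "2 ^ m * y < of_int \<lfloor>2 ^ m * y\<rfloor> + 1" by linarith+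
  then show "round_down m y \<le> y" "y < round_down m y + 1 / 2 ^ m"
    by (simp_all add: round_down_def field_simps)
qed

text \<open>Small items are rounded to 0, so the strategy has to cope with the closed
  interval.\<close>

lemma round_down_mem:
  assumes "y \<in> {0<..1}"
  shows "round_down m y \<in> {0..1}"
proof -
  have "0 \<le> round_down m y" using assms by (simp add: round_down_def)
  moreover have "round_down m y \<le> 1" using assms round_down_bounds(1)[of m y] by simp
  ultimately show ?thesis by simp
qed

text \<open>The end points of level \<open>i\<close> lie on the finer grid of level
  \<open>m\<close>, so rounding down never crosses them.\<close>

lemma dyadic_box_round_down:
  assumes "i \<le> m" "j < 2 ^ i" "y \<in> {real j / 2 ^ i<..<real (Suc j) / 2 ^ i}"
  shows "dyadic_box i (round_down m y) = j"
proof -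
  have pw: "(2::real) ^ m = 2 ^ i * 2 ^ (m - i)" using assms(1) by (simp add: power_add[symmetric])
  have "real j < 2 ^ i * y" "2 ^ i * y < real (Suc j)" using assms(3) by (auto simp: field_simps)
  have "real j * 2 ^ (m - i) \<le> 2 ^ m * y"
    unfolding pw using \<open>real j < 2 ^ i * y\<close> by (simp add: mult_ac)
  then have "of_int (int j * 2 ^ (m - i)) \<le> 2 ^ m * y" by simp
  then have "int j * 2 ^ (m - i) \<le> \<lfloor>2 ^ m * y\<rfloor>" by (simp add: le_floor_iff)
  then have "real_of_int (int j * 2 ^ (m - i)) \<le> of_int \<lfloor>2 ^ m * y\<rfloor>" by (simp only: of_int_le_iff)
  then have lo: "real j \<le> 2 ^ i * round_down m y"
    unfolding round_down_def pw by (simp add: field_simps)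
  have "2 ^ i * round_down m y \<le> 2 ^ i * y" using round_down_bounds(1) by (intro mult_left_mono) auto
  also have "\<dots> < real j + 1" using \<open>2 ^ i * y < real (Suc j)\<close> by simp
  finally have "2 ^ i * round_down m y < real j + 1" .
  then have "\<lfloor>2 ^ i * round_down m y\<rfloor> = int j" using lo by (intro floor_unique) auto
  then show ?thesis using assms(2) by (simp add: dyadic_box_def)
qed

text \<open>Rounding changes each jump by at most two grid steps, and there are fewer than 2^m
  jumps.\<close>

lemma array_cost_le_variation_rounded:
  assumes "real n \<le> 2 ^ m"
  shows "array_cost n A \<le> variation n (\<lambda>i. round_down m (A (Suc i))) + 2"
proof -
  let ?r = "\<lambda>i. round_down m (A (Suc i))"
  have "array_cost n A = (\<Sum>i<n - 1. \<bar>A (Suc (Suc i)) - A (Suc i)\<bar>)"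
    unfolding array_cost_def by (rule sum.reindex_bij_witness[of _ Suc "\<lambda>i. i - 1"]) auto
  also have "\<dots> \<le> (\<Sum>i<n - 1. \<bar>?r (Suc i) - ?r i\<bar> + 2 / 2 ^ m)"
  proof (rule sum_mono)
    fix i
    have "2 / 2 ^ m = 1 / 2 ^ m + (1 / 2 ^ m :: real)" by simp
    then show "\<bar>A (Suc (Suc i)) - A (Suc i)\<bar> \<le> \<bar>?r (Suc i) - ?r i\<bar> + 2 / 2 ^ m"
      using round_down_bounds(1)[of m "A (Suc (Suc i))"] round_down_bounds(2)[of "A (Suc (Suc i))" m]
        round_down_bounds(1)[of m "A (Suc i)"] round_down_bounds(2)[of "A (Suc i)" m] by linarith
  qed
  also have "\<dots> = variation n ?r + real (n - 1) * (2 / 2 ^ m)"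
    by (simp add: sum.distrib variation_def)
  also have "real (n - 1) * (2 / 2 ^ m) \<le> 2"
  proof -
    have "real (n - 1) \<le> 2 ^ m" using assms by linarith
    then show ?thesis by (simp add: field_simps)
  qed
  finally show ?thesis by simp
qed

text \<open>Open intervals may miss items on their end points, which only lowers the count; the
  strategy needs lower bounds, so this is the safe direction.\<close>

definition box_count :: "nat \<Rightarrow> nat \<Rightarrow> nat \<Rightarrow> (nat \<Rightarrow> real) \<Rightarrow> nat" where
  "box_count n i j x = card {t\<in>{1..n}. x t \<in> {real j / 2 ^ i<..<real (Suc j) / 2 ^ i}}"

context parameters
begin

lemma L_le_n: "L \<le> n"
proof -
  have "sqrt (real n) \<le> real n" using n_pos by (simp add: real_sqrt_le_iff' real_le_lsqrt power2_eq_square)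
  then have "(2::real) ^ L \<le> real n" using pow_le by linarith
  then have "2 ^ L \<le> n" by (metis of_nat_le_iff of_nat_numeral of_nat_power)
  then show ?thesis using less_exp[of L] by linarith
qed

theorem online_algorithm_exists:
  "\<exists>alg' :: int list \<Rightarrow> nat. online_sorting_algorithm n (\<lambda>h. alg' (map (\<lambda>y. \<lfloor>2 ^ n * y\<rfloor>) h)) \<and>
    (\<forall>x. (\<forall>t\<in>{1..n}. x t \<in> {0<..1}) \<and> (\<forall>i\<in>{1..L}. \<forall>j<2 ^ i. quota n i \<le> box_count n i j x) \<longrightarrow>
       online_cost n (\<lambda>h. alg' (map (\<lambda>y. \<lfloor>2 ^ n * y\<rfloor>) h)) x \<le> 2303 * R)"
proof -
  obtain F where F: "\<forall>ys. length ys = n \<and> set ys \<subseteq> {0..1} \<and>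
      (\<forall>i\<in>{1..L}. \<forall>j<2 ^ i. quota n i \<le> card {t. t < n \<and> dyadic_box i (ys ! t) = j}) \<longrightarrow>
    inj_on (\<lambda>t. F (take (Suc t) ys)) {..<n} \<and> (\<forall>t<n. F (take (Suc t) ys) < n) \<and>
    (\<forall>A. (\<forall>t<n. A (F (take (Suc t) ys)) = ys ! t) \<longrightarrow> variation n A \<le> 2301 * R)"
    using strategy_exists by (rule exE)
  \<comment> \<open>Shifts the cells 0, ..., n - 1 of the strategy to 1, ..., n.\<close>
  define H where "H = (\<lambda>h. Suc (F h))"
  define alg' where "alg' = (\<lambda>ks :: int list. fallback_alg n H (map (\<lambda>k. of_int k / 2 ^ n) ks))"
  have alg: "(\<lambda>h. alg' (map (\<lambda>y. \<lfloor>2 ^ n * y\<rfloor>) h)) = (\<lambda>h. fallback_alg n H (map (round_down n) h))"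
    by (simp add: alg'_def round_down_def[abs_def] o_def)
  have cell: "online_cell (\<lambda>h. fallback_alg n H (map (round_down n) h)) x j
     = online_cell (fallback_alg n H) (\<lambda>t. round_down n (x t)) j" for x j
    by (simp add: online_cell_def o_def del: upt_Suc)
  have valid: "online_sorting_algorithm n (\<lambda>h. fallback_alg n H (map (round_down n) h))"
    using fallback_alg_valid[of n H] unfolding online_sorting_algorithm_def cell by blast
  have cost: "online_cost n (\<lambda>h. fallback_alg n H (map (round_down n) h)) x \<le> 2303 * R"
    if x: "\<And>t. t \<in> {1..n} \<Longrightarrow> x t \<in> {0<..1}"
      and cnt: "\<And>i j. i \<in> {1..L} \<Longrightarrow> j < 2 ^ i \<Longrightarrow> quota n i \<le> box_count n i j x" for x
  proof -
    define z where "z = (\<lambda>t. round_down n (x t))"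
    define ys where "ys = map z [1..<Suc n]"
    have len: "length ys = n" by (simp add: ys_def del: upt_Suc)
    have nth: "ys ! t = z (Suc t)" if "t < n" for t using that by (simp add: ys_def del: upt_Suc)
    have tk: "map z [1..<Suc j] = take j ys" if "j \<in> {1..n}" for j
      using that by (simp add: ys_def take_map del: upt_Suc)
    have mem: "set ys \<subseteq> {0..1}"
      using x round_down_mem by (auto simp: ys_def z_def simp del: upt_Suc)
    have enough: "quota n i \<le> card {t. t < n \<and> dyadic_box i (ys ! t) = j}" if ij: "i \<in> {1..L}" "j < 2 ^ i" for i j
    proof -
      have "box_count n i j x \<le> card {t. t < n \<and> dyadic_box i (ys ! t) = j}"
        unfolding box_count_def
      proof (rule card_inj_on_le[where f = "\<lambda>t. t - 1"])
        show "inj_on (\<lambda>t. t - 1) {t \<in> {1..n}. x t \<in> {real j / 2 ^ i<..<real (Suc j) / 2 ^ i}}"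
          by (auto simp: inj_on_def)
        have "dyadic_box i (z t) = j" if "x t \<in> {real j / 2 ^ i<..<real (Suc j) / 2 ^ i}" for t
          unfolding z_def using ij L_le_n that by (intro dyadic_box_round_down) auto
        then show "(\<lambda>t. t - 1) ` {t \<in> {1..n}. x t \<in> {real j / 2 ^ i<..<real (Suc j) / 2 ^ i}}
            \<subseteq> {t. t < n \<and> dyadic_box i (ys ! t) = j}"
          by (auto simp: nth)
      qed simp
      with cnt[OF ij] show ?thesis by linarith
    qed
    have "length ys = n \<and> set ys \<subseteq> {0..1} \<and>
      (\<forall>i\<in>{1..L}. \<forall>j<2 ^ i. quota n i \<le> card {t. t < n \<and> dyadic_box i (ys ! t) = j})"
      using len mem enough by blast
    note FF = F[THEN spec, THEN mp, OF this]
    have Hj: "H (map z [1..<Suc j]) = Suc (F (take (Suc (j - 1)) ys))" if "j \<in> {1..n}" for j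
      using that tk[OF that] by (simp add: H_def)
    have H_range: "H (map z [1..<Suc j]) \<in> {1..n}" if "j \<in> {1..n}" for j
    proof -
      have "j - 1 < n" using that by auto
      then show ?thesis using FF unfolding Hj[OF that] by (auto simp: Suc_le_eq)
    qed
    have H_inj: "inj_on (\<lambda>j. H (map z [1..<Suc j])) {1..n}"
    proof (rule inj_onI)
      fix i j assume ij: "i \<in> {1..n}" "j \<in> {1..n}" "H (map z [1..<Suc i]) = H (map z [1..<Suc j])"
      then have "F (take (Suc (i - 1)) ys) = F (take (Suc (j - 1)) ys)" using Hj[OF ij(1)] Hj[OF ij(2)] by simp
      then have "i - 1 = j - 1" using FF ij(1,2) by (auto simp: inj_on_def)
      then show "i = j" using ij(1,2) by auto
    qed
    let ?p = "online_cell (\<lambda>h. fallback_alg n H (map (round_down n) h)) x"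
    have p: "?p j = Suc (F (take (Suc (j - 1)) ys))" if "j \<in> {1..n}" for j
    proof -
      have "?p j = online_cell (fallback_alg n H) z j" unfolding cell z_def ..
      also have "\<dots> = H (map z [1..<Suc j])" by (rule fallback_alg_eq[OF H_range H_inj that])
      finally show ?thesis unfolding Hj[OF that] .
    qed
    define B where "B = filled_array n x ?p"
    have "variation n (\<lambda>i. round_down n (B (Suc i))) \<le> 2301 * R"
    proof -
      have "round_down n (B (Suc (F (take (Suc t) ys)))) = ys ! t" if t: "t < n" for t
      proof -
        have "Suc (F (take (Suc t) ys)) = ?p (Suc t)" using p[of "Suc t"] t by simp
        moreover have "inv_into {1..n} ?p (?p (Suc t)) = Suc t"
          using online_cell_bij[OF valid, of x] t by (intro inv_into_f_f) (auto simp: bij_betw_def)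
        ultimately show ?thesis by (simp add: B_def filled_array_def nth[OF t] z_def)
      qed
      then show ?thesis using FF by simp
    qed
    moreover have "array_cost n B \<le> variation n (\<lambda>i. round_down n (B (Suc i))) + 2"
      by (rule array_cost_le_variation_rounded) (simp add: of_nat_less_two_power less_imp_le)
    \<comment> \<open>Turns the rounding loss 2 into at most 2 * \<open>R\<close>, whence
      2303.\<close>
    moreover have "R \<ge> 3" using L_le by (rule order_trans[rotated]) simp
    ultimately show ?thesis unfolding online_cost_def B_def[symmetric] by linarith
  qed
  show ?thesis
  proof (intro exI[of _ alg'] conjI allI impI; unfold alg)
    show "online_sorting_algorithm n (\<lambda>h. fallback_alg n H (map (round_down n) h))" by (rule valid)
  qed (use cost in blast)
qed

section \<open>Failure probability and competitive ratio for large inputs\<close>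

lemma box_deficit_prob:
  assumes "i \<in> {1..L}" "j < 2 ^ i"
  shows "measure (uniform_input n) {x \<in> space (uniform_input n). box_count n i j x < quota n i} \<le> 1 / (real n)\<^sup>2"
    and "{x \<in> space (uniform_input n). box_count n i j x < quota n i} \<in> sets (uniform_input n)"
proof -
  let ?a = "real j / 2 ^ i" and ?b = "real (Suc j) / 2 ^ i"
  have ab: "0 \<le> ?a" "?a < ?b" by (simp_all add: divide_strict_right_mono)
  have "real (Suc j) \<le> 2 ^ i" using assms(2) by (metis Suc_leI of_nat_le_iff of_nat_numeral of_nat_power)
  then have b1: "?b \<le> 1" by simp
  have diff: "real n * (?b - ?a) = real n / 2 ^ i" by (simp add: diff_divide_distrib[symmetric])
  have dev0: "dev n i \<ge> 0" using dev_ge[of i] assms(1) by simp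
  have q: "real (quota n i) \<le> real n * (?b - ?a) - dev n i"
    unfolding diff using quota_bounds(1)[of i] assms(1) by simp
  have n1: "1 \<le> n" using n_pos by simp
  have sq: "(dev n i)\<^sup>2 = 4 * (real n / 2 ^ i * ln (real n))"
    using ln_ge by (simp add: dev_def power_mult_distrib)
  have "exp (- ((dev n i)\<^sup>2 / (2 * (real n / 2 ^ i)))) = exp (- (2 * ln (real n)))"
    unfolding sq using n_pos by (simp add: field_simps)
  also have "\<dots> = 1 / (real n)\<^sup>2" using n_pos by (simp add: exp_minus exp_double divide_inverse)
  finally have e: "exp (- ((dev n i)\<^sup>2 / (2 * (real n * (?b - ?a))))) = 1 / (real n)\<^sup>2" unfolding diff .
  show "measure (uniform_input n) {x \<in> space (uniform_input n). box_count n i j x < quota n i} \<le> 1 / (real n)\<^sup>2"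
    using uniform_lower_tail(1)[OF ab b1 n1 dev0 q] unfolding e box_count_def .
  show "{x \<in> space (uniform_input n). box_count n i j x < quota n i} \<in> sets (uniform_input n)"
    using uniform_lower_tail(2)[OF ab b1 n1 dev0 q] unfolding box_count_def .
qed

text \<open>A positive quota at level 2 populates the first and the last quarter of the unit
  interval, so two items differ by more than 1/2.\<close>

lemma offline_opt_ge_half:
  assumes L2: "2 \<le> L" and q2: "1 \<le> quota n 2"
    and cnt: "\<And>i j. i \<in> {1..L} \<Longrightarrow> j < 2 ^ i \<Longrightarrow> quota n i \<le> box_count n i j x"
  shows "1 / 2 \<le> offline_opt n x"
proof -
  have "\<exists>t\<in>{1..n}. x t \<in> {real j / 2 ^ 2<..<real (Suc j) / 2 ^ 2}" if "j < 2 ^ 2" for j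
  proof (rule ccontr)
    assume "\<not> ?thesis"
    then have "box_count n 2 j x = 0" by (auto simp: box_count_def)
    then show False using cnt[of 2 j] that L2 q2 by simp
  qed
  from this[of 0] this[of 3] obtain a b where
    ab: "a \<in> {1..n}" "x a < 1/4" "b \<in> {1..n}" "x b > 3/4" by auto
  then show ?thesis using offline_opt_ge[of a n b x] by linarith
qed

text \<open>A union bound over all intervals of the levels 1 to \<open>L\<close>. The factor 4606 is
  twice 2303, because the optimum is at least 1/2.\<close>

theorem large_input:
  assumes L2: "2 \<le> L" and q2: "1 \<le> quota n 2"
  shows "\<exists>alg. online_sorting_algorithm n alg \<and>
    1 - 2 / real n \<le> measure (uniform_input n)
         {x \<in> space (uniform_input n). online_cost n alg x \<le> 4606 * R * offline_opt n x}"
proof -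
  obtain alg' :: "int list \<Rightarrow> nat" where
    valid: "online_sorting_algorithm n (\<lambda>h. alg' (map (\<lambda>y. \<lfloor>2 ^ n * y\<rfloor>) h))" and
    cost: "\<And>x. (\<And>t. t \<in> {1..n} \<Longrightarrow> x t \<in> {0<..1}) \<Longrightarrow>
      (\<And>i j. i \<in> {1..L} \<Longrightarrow> j < 2 ^ i \<Longrightarrow> quota n i \<le> box_count n i j x) \<Longrightarrow>
       online_cost n (\<lambda>h. alg' (map (\<lambda>y. \<lfloor>2 ^ n * y\<rfloor>) h)) x \<le> 2303 * R"
    using online_algorithm_exists by blast
  let ?alg = "\<lambda>h. alg' (map (\<lambda>y. \<lfloor>2 ^ n * y\<rfloor>) h)"
  let ?M = "uniform_input n"
  interpret prob_space ?M by (rule prob_space_uniform_input)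
  define E where "E = {x \<in> space ?M. online_cost n ?alg x \<le> 4606 * R * offline_opt n x}"
  define G where "G = (PiE {1..n} (\<lambda>_. {0<..1}) :: (nat \<Rightarrow> real) set)"
  define I where "I = (SIGMA i:{1..L}. {..<2 ^ i :: nat})"
  define bad where "bad = (\<lambda>(i, j). {x \<in> space ?M. box_count n i j x < quota n i})"
  define B where "B = (\<Union>k\<in>I. bad k)"
  have E_sets: "E \<in> sets ?M"
    unfolding E_def using valid by (intro success_event_measurable) (auto, measurable)
  have G: "G \<in> sets ?M" "measure ?M G = 1"
    unfolding G_def by (rule uniform_input_support)+
  have bad: "bad k \<in> sets ?M" "measure ?M (bad k) \<le> 1 / (real n)\<^sup>2" if "k \<in> I" for k
    using that box_deficit_prob by (auto simp: I_def bad_def)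
  have fin: "finite I" by (simp add: I_def)
  have B_sets: "B \<in> sets ?M" unfolding B_def using bad(1) fin by (intro sets.finite_UN) auto
  \<comment> \<open>There are at most 2 * 2^L intervals, hence at most 2 sqrt n; the cruder 2n
    already gives 2n / n^2 = 2 / n.\<close>
  have card_I: "real (card I) \<le> 2 * real n"
  proof -
    have "card I = (\<Sum>i = 1..L. 2 ^ i)" by (simp add: I_def)
    also have "\<dots> \<le> (\<Sum>i<Suc L. 2 ^ i)" by (intro sum_mono2) auto
    also have "\<dots> \<le> 2 * 2 ^ L" using sum_power2[of "Suc L"] by (simp only: lessThan_atLeast0) simp
    finally have "real (card I) \<le> real (2 * 2 ^ L)" by (simp only: of_nat_le_iff)
    moreover have "sqrt (real n) \<le> real n" using n_pos by (simp add: real_le_lsqrt power2_eq_square)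
    ultimately show ?thesis using pow_le by simp
  qed
  have "measure ?M B \<le> (\<Sum>k\<in>I. measure ?M (bad k))"
    unfolding B_def using bad(1) fin by (intro finite_measure_subadditive_finite) auto
  also have "\<dots> \<le> (\<Sum>k\<in>I. 1 / (real n)\<^sup>2)" using bad(2) by (rule sum_mono)
  also have "\<dots> = real (card I) / (real n)\<^sup>2" by simp
  also have "\<dots> \<le> 2 * real n / (real n)\<^sup>2" using card_I by (intro divide_right_mono) auto
  also have "\<dots> = 2 / real n" using n_pos by (simp add: power2_eq_square)
  finally have prob_B: "measure ?M B \<le> 2 / real n" .
  have "measure ?M (G - B) = measure ?M G - measure ?M (G \<inter> B)"
    using G B_sets by (intro finite_measure_Diff') auto
  moreover have "measure ?M (G \<inter> B) \<le> measure ?M B" using B_sets by (intro finite_measure_mono) auto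
  ultimately have "1 - 2 / real n \<le> measure ?M (G - B)" using G(2) prob_B by linarith
  also have "\<dots> \<le> measure ?M E"
  proof (rule finite_measure_mono[OF _ E_sets])
    show "G - B \<subseteq> E"
    proof
      fix x assume x: "x \<in> G - B"
      then have sp: "x \<in> space ?M" using sets.sets_into_space[OF G(1)] by auto
      have unit: "x t \<in> {0<..1}" if "t \<in> {1..n}" for t using x that by (auto simp: G_def PiE_def Pi_def)
      have cnt: "quota n i \<le> box_count n i j x" if "i \<in> {1..L}" "j < 2 ^ i" for i j
      proof (rule ccontr)
        assume "\<not> ?thesis"
        then have "x \<in> bad (i, j)" using sp by (simp add: bad_def)
        moreover have "(i, j) \<in> I" using that by (simp add: I_def)
        ultimately show False using x by (auto simp: B_def)
      qed
      have R0: "0 \<le> R" using ln_ge by simp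
      have "online_cost n ?alg x \<le> 2303 * R" by (rule cost[OF unit cnt])
      also have "\<dots> = 4606 * R * (1 / 2)" by simp
      also have "\<dots> \<le> 4606 * R * offline_opt n x"
        using offline_opt_ge_half[OF L2 q2 cnt] R0 by (intro mult_left_mono) auto
      finally show "x \<in> E" using sp by (simp add: E_def)
    qed
  qed
  finally show ?thesis using valid unfolding E_def by blast
qed

end

section \<open>Asymptotics and conclusion\<close>

lemma parameters_eventually:
  "eventually (\<lambda>n. parameters n (nat \<lfloor>log 2 (sqrt (real n))\<rfloor>) \<and>
     2 \<le> nat \<lfloor>log 2 (sqrt (real n))\<rfloor> \<and> 1 \<le> quota n 2) sequentially"
proof -
  have "eventually (\<lambda>n. 1 \<le> ln (real n)) sequentially"
    "eventually (\<lambda>n. 4 * ln (real n) \<le> sqrt (real n)) sequentially"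
    "eventually (\<lambda>n. 9 \<le> sqrt (real n) * ln (real n)) sequentially"
    "eventually (\<lambda>n. 3 * (log 2 (sqrt (real n)) + 1) \<le> sqrt (sqrt (real n * ln (real n)))) sequentially"
    "eventually (\<lambda>n. 4 \<le> sqrt (real n)) sequentially"
    "eventually (\<lambda>n. 1 \<le> real n / 2 ^ 2 - 2 * sqrt (real n / 2 ^ 2 * ln (real n))) sequentially"
    by real_asymp+
  then show ?thesis
  proof eventually_elim
    case (elim n)
    define L where "L = nat \<lfloor>log 2 (sqrt (real n))\<rfloor>"
    have s: "sqrt (real n) > 0" using elim(5) by linarith
    have lg: "2 \<le> log 2 (sqrt (real n))" using elim(5) s by (simp add: le_log_iff)
    then have L: "real L \<le> log 2 (sqrt (real n))" "log 2 (sqrt (real n)) < real L + 1" "2 \<le> L"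
      unfolding L_def by linarith+
    have "2 powr real L \<le> sqrt (real n)" using L(1) s by (simp add: le_log_iff)
    then have 1: "2 ^ L \<le> sqrt (real n)" by (simp add: powr_realpow)
    have "sqrt (real n) < 2 powr (real L + 1)" using L(2) s by (simp add: log_less_iff)
    then have 2: "sqrt (real n) \<le> 2 * 2 ^ L" by (simp add: powr_add powr_realpow)
    have "3 * (real L + 1) \<le> 3 * (log 2 (sqrt (real n)) + 1)" using L(1) by simp
    also note elim(4)
    finally have "parameters n L" using elim(1-3) 1 2 by unfold_locales
    moreover have "1 \<le> quota n 2" using elim(6) by (simp add: quota_def dev_def le_nat_iff le_floor_iff)
    ultimately show ?case using L(3) by (simp add: L_def)
  qed
qed

theorem theorem5:
  shows "\<exists>(alg :: nat \<Rightarrow> real list \<Rightarrow> nat) (ratio :: nat \<Rightarrow> real).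
    ratio \<in> O(\<lambda>n. (real n * ln (real n)) powr (1 / 4)) \<and>
    (\<forall>n\<ge>1. online_sorting_algorithm n (alg n) \<and>
       measure (uniform_input n)
         {x \<in> space (uniform_input n). online_cost n (alg n) x \<le> ratio n * offline_opt n x}
       \<ge> 1 - 2 / real n)"
proof -
  let ?R = "\<lambda>n. sqrt (sqrt (real n * ln (real n)))"
  obtain n0 where n0: "\<And>n. n \<ge> n0 \<Longrightarrow> parameters n (nat \<lfloor>log 2 (sqrt (real n))\<rfloor>) \<and>
     2 \<le> nat \<lfloor>log 2 (sqrt (real n))\<rfloor> \<and> 1 \<le> quota n 2"
    using parameters_eventually unfolding eventually_sequentially by blast
  \<comment> \<open>Below the threshold \<open>n0\<close> the ratio \<open>n\<close> is achieved by
    every valid algorithm, and finitely many values do not affect the growth rate.\<close>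
  define ratio where "ratio = (\<lambda>n. if n < n0 then real n else 4606 * ?R n)"
  have "\<exists>alg. online_sorting_algorithm n alg \<and> 1 - 2 / real n \<le> measure (uniform_input n)
         {x \<in> space (uniform_input n). online_cost n alg x \<le> ratio n * offline_opt n x}" if n: "n \<ge> 1" for n
  proof (cases "n < n0")
    case True
    interpret prob_space "uniform_input n" by (rule prob_space_uniform_input)
    \<comment> \<open>Cell 0 does not exist, so the fallback is taken at every step and items go to
      arbitrary free cells.\<close>
    let ?alg = "fallback_alg n (\<lambda>_. 0)"
    have "{x \<in> space (uniform_input n). online_cost n ?alg x \<le> ratio n * offline_opt n x} = space (uniform_input n)"
      using online_cost_le_opt[OF fallback_alg_valid n] True by (auto simp: ratio_def)
    then have "measure (uniform_input n)
      {x \<in> space (uniform_input n). online_cost n ?alg x \<le> ratio n * offline_opt n x} = 1"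
      using prob_space by simp
    then show ?thesis using fallback_alg_valid[of n "\<lambda>_. 0"] by (intro exI[of _ ?alg]) simp
  next
    case False
    then have P: "parameters n (nat \<lfloor>log 2 (sqrt (real n))\<rfloor>)" "2 \<le> nat \<lfloor>log 2 (sqrt (real n))\<rfloor>" "1 \<le> quota n 2"
      using n0[of n] by auto
    from parameters.large_input[OF this] show ?thesis using False by (simp only: ratio_def if_False)
  qed
  then have "\<forall>n. \<exists>alg. n \<ge> 1 \<longrightarrow> online_sorting_algorithm n alg \<and> 1 - 2 / real n \<le> measure (uniform_input n)
         {x \<in> space (uniform_input n). online_cost n alg x \<le> ratio n * offline_opt n x}" by blast
  from choice[OF this] obtain alg where alg: "\<And>n. n \<ge> 1 \<Longrightarrow> online_sorting_algorithm n (alg n) \<and> 1 - 2 / real n \<le> measure (uniform_input n)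
         {x \<in> space (uniform_input n). online_cost n (alg n) x \<le> ratio n * offline_opt n x}" by blast
  have "ratio \<in> O(\<lambda>n. (real n * ln (real n)) powr (1 / 4))"
  proof (rule bigoI[where c = 4606])
    show "eventually (\<lambda>n. norm (ratio n) \<le> 4606 * norm ((real n * ln (real n)) powr (1 / 4))) sequentially"
      using eventually_ge_at_top[of "max 1 n0"]
    proof eventually_elim
      case (elim n)
      have nn: "0 \<le> real n * ln (real n)" using elim by simp
      have "?R n = ((real n * ln (real n)) powr (1/2)) powr (1/2)" using nn by (simp add: powr_half_sqrt)
      also have "\<dots> = (real n * ln (real n)) powr (1/4)" by (simp add: powr_powr)
      finally show ?case using elim nn by (simp add: ratio_def)
    qed
  qed
  then show ?thesis using alg by blast
qed

end
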